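(* Let $\Omega$ and $\Omega'$ be domains in $\mathfrak{H}$ and let $f:\Omega\to\Omega'$ be a $\mathcal{C}^2$ orientation-preserving contact quasiconformal transformation with distortion function $K_f(p)$. For any family $\Sigma$ of oriented regular surfaces inside $\Omega$ we have $$\mathrm{Mod}(f(\Sigma))\le\iiint_\Omega K_f^{2/3}(p)\rho^{4/3}(p)\,d\mathcal{L}^3(p)\quad\text{for each }\rho\in\mathrm{Adm}(\Sigma).$$ If moreover $K_f$ is the maximal distortion of $f$ ($K_f(p)\le K_f$ for all $p$), then $$\frac{1}{K_f^{2/3}}\mathrm{Mod}(\Sigma)\le\mathrm{Mod}(f(\Sigma))\le K_f^{2/3}\,\mathrm{Mod}(\Sigma).$$
   Context: The Heisenberg group $\mathfrak{H}$ is $\mathbb{C}\times\mathbb{R}$ (points $(z,t)$, $z=x+iy$) with contact form $\omega=dt+2x\,dy-2y\,dx$. Let $X=\partial_x+2y\,\partial_t$, $Y=\partial_y-2x\,\partial_t$, $Z=\frac12(X-iY)$, $\overline{Z}=\frac12(X+iY)$. The horizontal plane at $p$ is the span of $X_p,Y_p$, with norm $\|\cdot\|$ making $X,Y$ orthonormal. A contact transformation is a diffeomorphism $f=(f_I,f_3):\Omega\to\Omega'$ between domains of $\mathfrak{H}$ ($f_I=f_1+if_2$) with $f^*\omega=\lambda\omega$, $\lambda$ non-vanishing; orientation-preserving means $\lambda>0$, and then $\lambda=|Zf_I|^2-|\overline{Z}f_I|^2=J_f^{1/2}$ ($J_f$ the Jacobian determinant). For $f$ of class $\mathcal{C}^2$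 the distortion function is $K_f(p)=\frac{|Zf_I(p)|+|\overline{Z}f_I(p)|}{|Zf_I(p)|-|\overline{Z}f_I(p)|}$ and the maximal distortion is $K_f=\mathrm{ess\,sup}_pK_f(p)$; $f$ is quasiconformal iff $K_f<\infty$. A regular surface in $\mathfrak{H}$ is a $\mathcal{C}^2$ regular oriented surface in $\mathbb{R}^3$ in the Euclidean sense. For a patch $\sigma(u,v)=(x,y,t)(u,v)$ the horizontal normal is $$N^h_\sigma=\left(\tfrac{\partial(y,t)}{\partial(u,v)}+2y\tfrac{\partial(x,y)}{\partial(u,v)}\right)X+\left(\tfrac{\partial(t,x)}{\partial(u,v)}-2x\tfrac{\partial(x,y)}{\partial(u,v)}\right)Y.$$ The horizontal area integral $\iint_{\mathcal S}\rho\,d\mathcal{S}^h$ is the integral of $\rho$ over $\mathcal S$ against the parametrisation-independent area element $d\mathcal{S}^h=\|N^h_\sigma(u,v)\|\,du\,dv$. For a family $\Sigma$ of regular surfaces, $\mathrm{Adm}(\Sigma)$ is the set of non-negative Borel functions $\rho$ on $\mathfrak{H}$ with $\iint_{\mathcal S}\rho\,d\mathcal{S}^h\ge1$ for every $\mathcal S\in\Sigma$, and $\mathrm{Mod}(\Sigma)=\inf_{\rho\in\mathrm{Adm}(\Sigma)}\iiint_{\mathfrak H}\rho^{4/3}\,d\mathcal{L}^3$, $\mathcal{L}^3$ being Lebesgue measure on $\mathbb{R}^3$. Also $f(\Sigma)=\{f(\mathcal S):\mathcal S\in\Sigma\}$. *)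

theory Defs
  imports "HOL-Analysis.Analysis" "HOL-Probability.Essential_Supremum"
begin

section \<open>The Heisenberg group\<close>

text \<open>
  Points are pairs \<open>(z, t)\<close>. The type \<open>complex \<times> real\<close> is Euclidean 3-space: its inner product
  is the standard one in the coordinates \<open>(x, y, t)\<close>, and \<open>lborel\<close> on it is Lebesgue measure
  (on Borel sets). Tangent vectors at a point are elements of the same type.
\<close>

type_synonym heis = "complex \<times> real"

definition contact_form :: "heis \<Rightarrow> heis \<Rightarrow> real" where
  "contact_form p v = snd v + 2 * Re (fst p) * Im (fst v) - 2 * Im (fst p) * Re (fst v)"

definition X_field :: "heis \<Rightarrow> heis" where
  "X_field p = (1, 2 * Im (fst p))"

definition Y_field :: "heis \<Rightarrow> heis" where
  "Y_field p = (\<i>, - 2 * Re (fst p))"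

definition Z_deriv :: "(heis \<Rightarrow> complex) \<Rightarrow> heis \<Rightarrow> complex" where
  "Z_deriv g p = (frechet_derivative g (at p) (X_field p)
                   - \<i> * frechet_derivative g (at p) (Y_field p)) / 2"

definition Zbar_deriv :: "(heis \<Rightarrow> complex) \<Rightarrow> heis \<Rightarrow> complex" where
  "Zbar_deriv g p = (frechet_derivative g (at p) (X_field p)
                      + \<i> * frechet_derivative g (at p) (Y_field p)) / 2"

definition is_domain :: "heis set \<Rightarrow> bool" where
  "is_domain \<Omega> \<longleftrightarrow> open \<Omega> \<and> connected \<Omega> \<and> \<Omega> \<noteq> {}"


section \<open>Contact and quasiconformal transformations\<close>

definition C2_on :: "('a::euclidean_space \<Rightarrow> 'b::euclidean_space) \<Rightarrow> 'a set \<Rightarrow> bool" where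
  "C2_on f U \<longleftrightarrow>
     (\<exists>(f' :: 'a \<Rightarrow> 'a \<Rightarrow>\<^sub>L 'b) (f'' :: 'a \<Rightarrow> 'a \<Rightarrow>\<^sub>L 'a \<Rightarrow>\<^sub>L 'b).
        (\<forall>x\<in>U. (f has_derivative blinfun_apply (f' x)) (at x)) \<and>
        (\<forall>x\<in>U. (f' has_derivative blinfun_apply (f'' x)) (at x)) \<and>
        continuous_on U f'')"

definition C2_diffeomorphism :: "(heis \<Rightarrow> heis) \<Rightarrow> heis set \<Rightarrow> heis set \<Rightarrow> bool" where
  "C2_diffeomorphism f \<Omega> \<Omega>' \<longleftrightarrow>
     bij_betw f \<Omega> \<Omega>' \<and> C2_on f \<Omega> \<and> C2_on (inv_into \<Omega> f) \<Omega>'"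

text \<open>\<open>f\<^sup>*\<omega> = \<lambda>\<omega>\<close> on \<open>\<Omega>\<close>. As \<open>\<omega>\<close> vanishes nowhere, \<open>\<lambda>\<close> is unique on \<open>\<Omega>\<close>.\<close>

definition conformal_factor :: "(heis \<Rightarrow> heis) \<Rightarrow> heis set \<Rightarrow> (heis \<Rightarrow> real) \<Rightarrow> bool" where
  "conformal_factor f \<Omega> l \<longleftrightarrow>
     (\<forall>p\<in>\<Omega>. \<forall>v. contact_form (f p) (frechet_derivative f (at p) v) = l p * contact_form p v)"

definition contact_transformation :: "(heis \<Rightarrow> heis) \<Rightarrow> heis set \<Rightarrow> heis set \<Rightarrow> bool" where
  "contact_transformation f \<Omega> \<Omega>' \<longleftrightarrow>
     C2_diffeomorphism f \<Omega> \<Omega>' \<and> (\<exists>l. conformal_factor f \<Omega> l \<and> (\<forall>p\<in>\<Omega>. l p \<noteq> 0))"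

definition orientation_preserving :: "(heis \<Rightarrow> heis) \<Rightarrow> heis set \<Rightarrow> bool" where
  "orientation_preserving f \<Omega> \<longleftrightarrow> (\<exists>l. conformal_factor f \<Omega> l \<and> (\<forall>p\<in>\<Omega>. l p > 0))"

definition distortion :: "(heis \<Rightarrow> heis) \<Rightarrow> heis \<Rightarrow> real" where
  "distortion f p =
     (let a = norm (Z_deriv (\<lambda>q. fst (f q)) p); b = norm (Zbar_deriv (\<lambda>q. fst (f q)) p)
      in (a + b) / (a - b))"

definition max_distortion :: "(heis \<Rightarrow> heis) \<Rightarrow> heis set \<Rightarrow> ereal" where
  "max_distortion f \<Omega> = esssup (restrict_space lborel \<Omega>) (\<lambda>p. ereal (distortion f p))"

definition quasiconformal :: "(heis \<Rightarrow> heis) \<Rightarrow> heis set \<Rightarrow> bool" where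
  "quasiconformal f \<Omega> \<longleftrightarrow> max_distortion f \<Omega> < \<infinity>"


section \<open>Regular surfaces\<close>

text \<open>A regular patch of \<open>S\<close> is a \<open>C\<^sup>2\<close> immersion of an open set of parameters that is a
  homeomorphism onto a relatively open part of \<open>S\<close>.\<close>

definition regular_patch ::
    "heis set \<Rightarrow> (real \<times> real) set \<Rightarrow> (real \<times> real \<Rightarrow> heis) \<Rightarrow> bool" where
  "regular_patch S U \<sigma> \<longleftrightarrow>
     open U \<and> C2_on \<sigma> U \<and> (\<forall>w\<in>U. inj (frechet_derivative \<sigma> (at w))) \<and>
     openin (top_of_set S) (\<sigma> ` U) \<and> (\<exists>g. homeomorphism U (\<sigma> ` U) \<sigma> g)"

definition regular_surface :: "heis set \<Rightarrow> bool" where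
  "regular_surface S \<longleftrightarrow> (\<forall>p\<in>S. \<exists>U \<sigma>. regular_patch S U \<sigma> \<and> p \<in> \<sigma> ` U)"

text \<open>An oriented surface is a pair \<open>(S, \<nu>)\<close>, where \<open>\<nu>\<close> is a continuous field of Euclidean unit
  normals on \<open>S\<close>; the values of \<open>\<nu>\<close> off \<open>S\<close> are irrelevant.\<close>

type_synonym oriented_surface = "heis set \<times> (heis \<Rightarrow> heis)"

definition oriented_regular_surface :: "oriented_surface \<Rightarrow> bool" where
  "oriented_regular_surface = (\<lambda>(S, \<nu>).
     regular_surface S \<and> continuous_on S \<nu> \<and> (\<forall>p\<in>S. norm (\<nu> p) = 1) \<and>
     (\<forall>U \<sigma>. regular_patch S U \<sigma> \<longrightarrow>
        (\<forall>w\<in>U. \<forall>h. \<nu> (\<sigma> w) \<bullet> frechet_derivative \<sigma> (at w) h = 0)))"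

text \<open>The normals of \<open>f(S)\<close> at \<open>f(p)\<close> are the images of the normals of \<open>S\<close> at \<open>p\<close> under the
  inverse transpose of \<open>Df(p)\<close>. A contact transformation has Jacobian \<open>\<lambda>\<^sup>2 > 0\<close>, so this is the
  orientation carried over from \<open>S\<close>: positive patches \<open>\<sigma>\<close> go to positive patches \<open>f \<circ> \<sigma>\<close>.\<close>

definition surface_image :: "(heis \<Rightarrow> heis) \<Rightarrow> oriented_surface \<Rightarrow> oriented_surface" where
  "surface_image f = (\<lambda>(S, \<nu>).
     (f ` S,
      \<lambda>q. let p = inv_into S f q;
              n = adjoint (inv (frechet_derivative f (at p))) (\<nu> p)
          in n /\<^sub>R norm n))"


section \<open>Horizontal area\<close>

text \<open>The horizontal normal of a patch, given by its components in the frame \<open>X, Y\<close>. This frame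
  is orthonormal in the horizontal plane, so the norm of the horizontal normal is the
  Euclidean norm of this pair.\<close>

definition horizontal_normal :: "(real \<times> real \<Rightarrow> heis) \<Rightarrow> real \<times> real \<Rightarrow> real \<times> real" where
  "horizontal_normal \<sigma> w =
     (let a = frechet_derivative \<sigma> (at w) (1, 0);
          b = frechet_derivative \<sigma> (at w) (0, 1);
          x = Re (fst (\<sigma> w)); y = Im (fst (\<sigma> w));
          xu = Re (fst a); yu = Im (fst a); tu = snd a;
          xv = Re (fst b); yv = Im (fst b); tv = snd b;
          Jyt = yu * tv - yv * tu;
          Jtx = tu * xv - tv * xu;
          Jxy = xu * yv - xv * yu
      in (Jyt + 2 * y * Jxy, Jtx - 2 * x * Jxy))"

definition patch_integral ::
    "(heis \<Rightarrow> real) \<Rightarrow> (real \<times> real) set \<Rightarrow> (real \<times> real \<Rightarrow> heis) \<Rightarrow> heis set \<Rightarrow> ennreal" where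
  "patch_integral \<rho> U \<sigma> B =
     (\<integral>\<^sup>+ w\<in>{w \<in> U. \<sigma> w \<in> B}. ennreal (\<rho> (\<sigma> w) * norm (horizontal_normal \<sigma> w)) \<partial>lborel)"

text \<open>A decomposition of \<open>S\<close> into countably many disjoint Borel pieces (possibly empty), each
  contained in the image of a patch. Every regular surface has one, as it is covered by
  countably many patches.\<close>

definition patch_decomposition ::
    "heis set \<Rightarrow> (nat \<Rightarrow> (real \<times> real) set) \<Rightarrow> (nat \<Rightarrow> real \<times> real \<Rightarrow> heis) \<Rightarrow>
     (nat \<Rightarrow> heis set) \<Rightarrow> bool" where
  "patch_decomposition S U \<sigma> B \<longleftrightarrow>
     (\<forall>n. regular_patch S (U n) (\<sigma> n) \<and> B n \<in> sets borel \<and> B n \<subseteq> \<sigma> n ` U n) \<and>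
     disjoint_family B \<and> (\<Union>n. B n) = S"

text \<open>The integral over \<open>S\<close> is the sum of the integrals over the pieces of a patch decomposition.
  The area element does not depend on the parametrisation, so all decompositions give the same
  sum for Borel \<open>\<rho> \<ge> 0\<close>; the supremum only serves to pick out this common value.\<close>

definition surface_integral :: "heis set \<Rightarrow> (heis \<Rightarrow> real) \<Rightarrow> ennreal" where
  "surface_integral S \<rho> =
     (SUP (U, \<sigma>, B) \<in> {(U, \<sigma>, B). patch_decomposition S U \<sigma> B}.
        \<Sum>n. patch_integral \<rho> (U n) (\<sigma> n) (B n))"


section \<open>Modulus of a family of surfaces\<close>

definition Adm :: "oriented_surface set \<Rightarrow> (heis \<Rightarrow> real) set" where
  "Adm \<Sigma> = {\<rho>. \<rho> \<in> borel_measurable borel \<and> (\<forall>p. 0 \<le> \<rho> p) \<and>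
                (\<forall>S\<in>\<Sigma>. 1 \<le> surface_integral (fst S) \<rho>)}"

definition Mod :: "oriented_surface set \<Rightarrow> ennreal" where
  "Mod \<Sigma> = (INF \<rho>\<in>Adm \<Sigma>. \<integral>\<^sup>+ p. ennreal (\<rho> p powr (4/3)) \<partial>lborel)"

end

theory Submission
  imports Defs
begin

text \<open>
  Let \<open>s = \<bar>Zf\<bar> - \<bar>Zbarf\<bar>\<close> and \<open>t = \<bar>Zf\<bar> + \<bar>Zbarf\<bar>\<close> denote the least and the greatest factor by which
  \<open>Df\<close> stretches horizontal vectors. On horizontal planes \<open>Df\<close> has determinant \<open>s t\<close>, and
  differentiating \<open>f\<^sup>*\<omega> = \<lambda>\<omega>\<close> shows that this determinant is the conformal factor: \<open>\<lambda> = s t\<close>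
  (\<open>horizontal_area\<close>, \<open>factor_eq_norms\<close>). This is the step that takes two derivatives of \<open>f\<close> and uses
  their symmetry. Since \<open>Df\<close> is block triangular in the frame \<open>X, Y, \<partial>\<^sub>t\<close>, the Jacobian is
  \<open>\<lambda>\<^sup>2\<close> (\<open>det_Df\<close>).

  The horizontal normal of a surface is, up to a rotation by a right angle, the horizontal tangent
  vector \<open>\<omega>(a) b - \<omega>(b) a\<close> for a basis \<open>a, b\<close> of the tangent plane. A contact map multiplies \<open>\<omega>\<close> by \<open>\<lambda>\<close>
  and stretches the horizontal vector, so it multiplies horizontal area by a factor between \<open>\<lambda> s\<close> and
  \<open>\<lambda> t\<close> (\<open>horizontal_normal_compose\<close>).

  Hence, if \<open>\<rho>\<close> is admissible for \<open>\<Sigma>\<close>, the density \<open>\<rho> / (\<lambda> s)\<close> transported to \<open>\<Omega>'\<close> is admissible for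
  \<open>f(\<Sigma>)\<close> (\<open>Adm_push\<close>), and by the change of variables its \<open>4/3\<close>-energy is
  \<open>\<integral> (\<rho> / (s\<^sup>2 t))\<^bsup>4/3\<^esup> (s t)\<^sup>2 = \<integral> (t/s)\<^bsup>2/3\<^esup> \<rho>\<^bsup>4/3\<^esup>\<close>, the weighted energy in the
  first claim (\<open>nn_integral_push\<close>). Bounding the distortion \<open>t/s\<close> by its essential supremum gives the upper
  estimate of the modulus. For the lower one, a density admissible for \<open>f(\<Sigma>)\<close> is pulled back and
  multiplied by \<open>\<lambda> t\<close> (\<open>Adm_pull\<close>), at the cost of the same power of the distortion
  (\<open>nn_integral_pull\<close>).

  Surface integrals are compared patch by patch, because \<open>f\<close> carries patch decompositions of \<open>S\<close> to
  patch decompositions of \<open>f(S)\<close> (\<open>surface_integral_le_image\<close>).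
\<close>

section \<open>Second derivatives and compositions of class \<open>C\<^sup>2\<close>\<close>

text \<open>
  The second difference \<open>\<Delta> u v t\<close> is symmetric in \<open>u\<close> and \<open>v\<close>. Tested against a vector \<open>w\<close> it is,
  by the mean value theorem, a difference of values of \<open>f'\<close>, and differentiability of \<open>f'\<close> at \<open>x\<close>
  gives \<open>\<Delta> u v t \<bullet> w = t\<^sup>2 * (f'' v u \<bullet> w) + o(t\<^sup>2)\<close>. Taking \<open>w\<close> to be the difference of the two
  mixed derivatives shows that this difference is zero.
\<close>

lemma symmetric_second_derivative:
  fixes f :: "'a::real_normed_vector \<Rightarrow> 'b::real_inner" and f' :: "'a \<Rightarrow> 'a \<Rightarrow>\<^sub>L 'b"
  assumes "open U" and "x \<in> U"
    and deriv: "\<And>y. y \<in> U \<Longrightarrow> (f has_derivative blinfun_apply (f' y)) (at y)"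
    and deriv2: "(f' has_derivative blinfun_apply f'') (at x)"
  shows "f'' u v = f'' v u"
proof -
  define w where "w = f'' u v - f'' v u"
  define \<Delta> where
    "\<Delta> u v t = f (x + t *\<^sub>R u + t *\<^sub>R v) - f (x + t *\<^sub>R u) - f (x + t *\<^sub>R v) + f x" for u v t
  have key: "\<bar>w \<bullet> w\<bar> \<le> e * (2 * (norm u + norm v)\<^sup>2 * norm w)" if "e > 0" for e
  proof -
    obtain d1 where "d1 > 0"
      and d1: "\<And>y. norm (y - x) < d1 \<Longrightarrow> norm (f' y - f' x - f'' (y - x)) \<le> e * norm (y - x)"
      using deriv2 \<open>e > 0\<close> unfolding has_derivative_at_alt by blast
    obtain d2 where "d2 > 0" and d2: "ball x d2 \<subseteq> U"
      using \<open>open U\<close> \<open>x \<in> U\<close> openE by blast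
    \<comment> \<open>A step so short that all four corners of the parallelogram lie in the ball where the
      first-order expansion of \<open>f'\<close> holds with error \<open>e\<close>.\<close>
    define n where "n = norm u + norm v + 1"
    define t where "t = min d1 d2 / (2 * n)"
    have "n > 0"
      by (smt (verit) n_def norm_ge_zero)
    then have "t > 0"
      using \<open>d1 > 0\<close> \<open>d2 > 0\<close> by (simp add: t_def)
    have "t * (norm u + norm v) < t * n"
      using \<open>t > 0\<close> by (simp add: n_def)
    also have "\<dots> = min d1 d2 / 2"
      using \<open>n > 0\<close> by (simp add: t_def)
    also have "\<dots> < min d1 d2"
      using \<open>d1 > 0\<close> \<open>d2 > 0\<close> by linarith
    finally have small: "t * (norm u + norm v) < min d1 d2" .
    have \<Delta>_approx: "\<bar>\<Delta> u v t \<bullet> w - t\<^sup>2 * (f'' v u \<bullet> w)\<bar> \<le> 2 * e * t\<^sup>2 * (norm u + norm v) * norm u * norm w"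
      if small: "t * (norm u + norm v) < min d1 d2" for u v
    proof -
      define h where "h s = (s * t) *\<^sub>R u" for s
      have bound: "norm (h s + c *\<^sub>R v) \<le> t * (norm u + norm v)"
        if "0 \<le> s" "s \<le> 1" "c \<in> {0, t}" for s c
      proof -
        have "norm (h s) \<le> t * norm u"
          using that \<open>t > 0\<close> by (simp add: h_def abs_mult mult_left_le_one_le mult_right_mono)
        moreover have "norm (c *\<^sub>R v) \<le> t * norm v"
          using that \<open>t > 0\<close> by auto
        ultimately show ?thesis
          by (smt (verit) norm_triangle_ineq distrib_left)
      qed
      have inU: "x + (h s + c *\<^sub>R v) \<in> U" if "0 \<le> s" "s \<le> 1" "c \<in> {0, t}" for s c
        using bound[OF that] small norm_minus_cancel[of "h s + c *\<^sub>R v"]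
        by (intro subsetD[OF d2]) (simp add: dist_norm)
      define g where "g s = (f (x + (h s + t *\<^sub>R v)) - f (x + (h s + 0 *\<^sub>R v))) \<bullet> w" for s
      define g' where
        "g' s = (\<lambda>r. ((f' (x + (h s + t *\<^sub>R v)) - f' (x + (h s + 0 *\<^sub>R v))) ((r * t) *\<^sub>R u)) \<bullet> w)" for s
      have "(g has_derivative g' s) (at s within {0..1})" if s: "0 \<le> s" "s \<le> 1" for s
      proof -
        have *: "((\<lambda>s. f (x + (h s + c *\<^sub>R v))) has_derivative (\<lambda>r. f' (x + (h s + c *\<^sub>R v)) ((r * t) *\<^sub>R u)))
               (at s within {0..1})" if "c \<in> {0, t}" for c
        proof -
          have "((\<lambda>s. x + (h s + c *\<^sub>R v)) has_derivative (\<lambda>r. (r * t) *\<^sub>R u)) (at s within {0..1})"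
            unfolding h_def by (auto intro!: derivative_eq_intros)
          from has_derivative_compose[OF this deriv[OF inU[OF s that]]] show ?thesis .
        qed
        show ?thesis
          unfolding g_def g'_def
          by (rule derivative_eq_intros * | simp add: blinfun.bilinear_simps inner_diff_left algebra_simps)+
      qed
      from mvt_simple[of 0 1 g g', OF _ this] obtain s where s: "0 < s" "s < 1"
        and mvt: "g 1 - g 0 = g' s 1"
        by auto
      \<comment> \<open>The two points where \<open>f'\<close> is evaluated differ by \<open>t *\<^sub>R v\<close>, so up to the Taylor remainders \<open>R\<close>
        the derivative increment is \<open>f'' (t *\<^sub>R v)\<close>.\<close>
      define R where "R k = f' (x + k) - f' x - f'' k" for k
      define h1 where "h1 = h s + t *\<^sub>R v"
      define h2 where "h2 = h s + 0 *\<^sub>R v"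
      have n1: "norm h1 \<le> t * (norm u + norm v)" and n2: "norm h2 \<le> t * (norm u + norm v)"
        unfolding h1_def h2_def by (rule bound; use s in simp)+
      have R: "norm (R k) \<le> e * (t * (norm u + norm v))" if "norm k \<le> t * (norm u + norm v)" for k
      proof -
        have "norm (R k) \<le> e * norm k"
          using d1[of "x + k"] that small by (simp add: R_def)
        also have "\<dots> \<le> e * (t * (norm u + norm v))"
          using that \<open>e > 0\<close> by simp
        finally show ?thesis .
      qed
      have "f' (x + h1) - f' (x + h2) = R h1 - R h2 + f'' (t *\<^sub>R v)"
        by (simp add: R_def h1_def h2_def blinfun.bilinear_simps)
      moreover have "g' s 1 = (f' (x + h1) - f' (x + h2)) (t *\<^sub>R u) \<bullet> w"
        by (simp only: g'_def h1_def h2_def mult_1)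
      ultimately have "g' s 1 = (R h1 - R h2 + f'' (t *\<^sub>R v)) (t *\<^sub>R u) \<bullet> w"
        by simp
      then have "g' s 1 = (R h1 - R h2) (t *\<^sub>R u) \<bullet> w + t\<^sup>2 * (f'' v u \<bullet> w)"
        by (simp add: blinfun.add_left blinfun.scaleR_left blinfun.scaleR_right inner_add_left power2_eq_square distrib_left)
      moreover have "g 1 - g 0 = \<Delta> u v t \<bullet> w"
        by (simp add: g_def h_def \<Delta>_def inner_diff_left inner_add_left add_ac)
      ultimately have "\<bar>\<Delta> u v t \<bullet> w - t\<^sup>2 * (f'' v u \<bullet> w)\<bar> = \<bar>(R h1 - R h2) (t *\<^sub>R u) \<bullet> w\<bar>"
        using mvt by simp
      also have "\<dots> \<le> norm ((R h1 - R h2) (t *\<^sub>R u)) * norm w"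
        by (rule Cauchy_Schwarz_ineq2)
      also have "\<dots> \<le> (norm (R h1 - R h2) * norm (t *\<^sub>R u)) * norm w"
        by (intro mult_right_mono norm_blinfun) auto
      also have "\<dots> \<le> (2 * (e * (t * (norm u + norm v))) * norm (t *\<^sub>R u)) * norm w"
        using norm_triangle_ineq4[of "R h1" "R h2"] R[OF n1] R[OF n2]
        by (intro mult_right_mono) auto
      also have "\<dots> = 2 * e * t\<^sup>2 * (norm u + norm v) * norm u * norm w"
        using \<open>t > 0\<close> by (simp add: power2_eq_square)
      finally show ?thesis .
    qed
    have "\<Delta> v u t = \<Delta> u v t"
      by (simp add: \<Delta>_def add_ac)
    then have "\<bar>t\<^sup>2 * (f'' u v \<bullet> w) - t\<^sup>2 * (f'' v u \<bullet> w)\<bar> \<le>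
        2 * e * t\<^sup>2 * (norm u + norm v) * norm u * norm w + 2 * e * t\<^sup>2 * (norm u + norm v) * norm v * norm w"
      using \<Delta>_approx[of u v] \<Delta>_approx[of v u] small by (simp add: add.commute)
    then have "t\<^sup>2 * \<bar>w \<bullet> w\<bar> \<le> t\<^sup>2 * (e * (2 * (norm u + norm v)\<^sup>2 * norm w))"
      by (simp add: w_def inner_diff_left abs_mult right_diff_distrib[symmetric])
         (simp add: algebra_simps power2_eq_square)
    then show ?thesis
      using \<open>t > 0\<close> by simp
  qed
  have "\<bar>w \<bullet> w\<bar> \<le> 0"
  proof (rule field_le_epsilon)
    fix e :: real assume "e > 0"
    define C where "C = 2 * (norm u + norm v)\<^sup>2 * norm w"
    have "C \<ge> 0" by (simp add: C_def)
    have "e / (C + 1) > 0"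
      using \<open>e > 0\<close> \<open>C \<ge> 0\<close> by simp
    from key[OF this] have "\<bar>w \<bullet> w\<bar> \<le> e / (C + 1) * C"
      by (simp only: C_def)
    also have "\<dots> \<le> e"
      using \<open>e > 0\<close> \<open>C \<ge> 0\<close> by (simp add: field_simps)
    finally show "\<bar>w \<bullet> w\<bar> \<le> 0 + e" by simp
  qed
  then have "w = 0"
    by (simp only: abs_le_zero_iff inner_eq_zero_iff)
  then show ?thesis
    by (simp add: w_def)
qed

lemma C2_on_compose:
  fixes \<sigma> :: "'a::euclidean_space \<Rightarrow> 'b::euclidean_space" and g :: "'b \<Rightarrow> 'c::euclidean_space"
  assumes g: "C2_on g V" and \<sigma>: "C2_on \<sigma> U" and sub: "\<sigma> ` U \<subseteq> V"
  shows "C2_on (g \<circ> \<sigma>) U"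
proof -
  from \<sigma> obtain s :: "'a \<Rightarrow> 'a \<Rightarrow>\<^sub>L 'b" and s2 :: "'a \<Rightarrow> 'a \<Rightarrow>\<^sub>L 'a \<Rightarrow>\<^sub>L 'b"
    where s: "\<And>x. x \<in> U \<Longrightarrow> (\<sigma> has_derivative s x) (at x)"
      and s2: "\<And>x. x \<in> U \<Longrightarrow> (s has_derivative s2 x) (at x)" and s2c: "continuous_on U s2"
    unfolding C2_on_def by blast
  from g obtain d :: "'b \<Rightarrow> 'b \<Rightarrow>\<^sub>L 'c" and d2 :: "'b \<Rightarrow> 'b \<Rightarrow>\<^sub>L 'b \<Rightarrow>\<^sub>L 'c"
    where d: "\<And>x. x \<in> V \<Longrightarrow> (g has_derivative d x) (at x)"
      and d2: "\<And>x. x \<in> V \<Longrightarrow> (d has_derivative d2 x) (at x)" and d2c: "continuous_on V d2"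
    unfolding C2_on_def by blast
  have sc: "continuous_on U \<sigma>" "continuous_on U s"
    using s s2 by (meson has_derivative_continuous continuous_at_imp_continuous_on)+
  have dc: "continuous_on V d"
    using d2 by (meson has_derivative_continuous continuous_at_imp_continuous_on)
  \<comment> \<open>the product rule applied to the chain rule formula for the first derivative\<close>
  define D2 where "D2 x u = (d (\<sigma> x) o\<^sub>L s2 x u) + (d2 (\<sigma> x) (s x u) o\<^sub>L s x)" for x u
  have der2: "((\<lambda>x. d (\<sigma> x) o\<^sub>L s x) has_derivative D2 x) (at x)" if "x \<in> U" for x
  proof -
    have "\<sigma> x \<in> V" using sub that by auto
    have "((\<lambda>x. d (\<sigma> x)) has_derivative (\<lambda>u. d2 (\<sigma> x) (s x u))) (at x)"
      by (rule has_derivative_compose[OF s[OF that] d2[OF \<open>\<sigma> x \<in> V\<close>]])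
    from bounded_bilinear.FDERIV[OF bounded_bilinear_blinfun_compose this s2[OF that]]
    show ?thesis by (simp add: D2_def[abs_def])
  qed
  have D2: "blinfun_apply (Blinfun (D2 x)) = D2 x" if "x \<in> U" for x
    by (rule bounded_linear_Blinfun_apply) (rule has_derivative_bounded_linear[OF der2[OF that]])
  have "continuous_on U (\<lambda>x. D2 x i)" for i
    unfolding D2_def
    by (intro continuous_intros sc s2c continuous_on_compose2[OF dc sc(1) sub]
      continuous_on_compose2[OF d2c sc(1) sub]
      bounded_bilinear.continuous_on[OF bounded_bilinear_blinfun_compose])
  then have "continuous_on U (\<lambda>x. Blinfun (D2 x) i)" for i
    by (rule continuous_on_eq) (simp add: D2)
  then have "continuous_on U (\<lambda>x. Blinfun (D2 x))"
    by (rule continuous_on_blinfun_componentwise)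
  moreover have "((g \<circ> \<sigma>) has_derivative (d (\<sigma> x) o\<^sub>L s x)) (at x)" if "x \<in> U" for x
    using diff_chain_at[OF s[OF that] d, of ] sub that
    by (auto simp: o_def blinfun_compose.rep_eq)
  ultimately show ?thesis
    unfolding C2_on_def using der2 D2
    by (intro exI[of _ "\<lambda>x. d (\<sigma> x) o\<^sub>L s x"] exI[of _ "\<lambda>x. Blinfun (D2 x)"]) simp
qed

lemma C2_on_imp_continuous_on: "C2_on f U \<Longrightarrow> continuous_on U f"
  unfolding C2_on_def by (meson has_derivative_continuous continuous_at_imp_continuous_on)

lemma C2_on_imp_differentiable: "C2_on f U \<Longrightarrow> x \<in> U \<Longrightarrow> f differentiable (at x)"
  unfolding C2_on_def by (meson differentiable_def)

section \<open>Change of variables on the Heisenberg group\<close>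

text \<open>
  For non-negative integrands the integrable version of the change of variables decides everything:
  one side is finite iff its integrand is absolutely integrable, and absolute integrability passes
  from either side to the other, together with the value of the integral.
\<close>

lemma nn_integral_change_of_variables_cart:
  fixes g :: "real^'m::{finite,wellorder} \<Rightarrow> real^'m::_" and h :: "real^'m::_ \<Rightarrow> real"
  assumes S: "S \<in> sets borel" and gS: "g ` S \<in> sets borel"
    and der: "\<And>x. x \<in> S \<Longrightarrow> (g has_derivative g' x) (at x)"
    and inj: "inj_on g S"
    and nonneg: "\<And>y. 0 \<le> h y" and h: "h \<in> borel_measurable borel"
    and h': "(\<lambda>x. indicator S x * (\<bar>det (matrix (g' x))\<bar> * h (g x))) \<in> borel_measurable borel"
  shows "(\<integral>\<^sup>+y\<in>g ` S. ennreal (h y) \<partial>lborel) =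
         (\<integral>\<^sup>+x\<in>S. ennreal (\<bar>det (matrix (g' x))\<bar> * h (g x)) \<partial>lborel)"
proof -
  define k where "k x = \<bar>det (matrix (g' x))\<bar> * h (g x)" for x
  have k_nonneg: "0 \<le> k x" for x
    using nonneg by (simp add: k_def)
  have cov: "k absolutely_integrable_on S \<and> integral S k = b \<longleftrightarrow>
        h absolutely_integrable_on (g ` S) \<and> integral (g ` S) h = b" for b
  proof -
    \<comment> \<open>The integrable version is about vector-valued integrands, so \<open>h\<close> is read as a map into \<open>real^1\<close>.\<close>
    have vec1: "f absolutely_integrable_on T \<and> integral T f = b \<longleftrightarrow>
        (\<lambda>x. vec (f x) :: real^1) absolutely_integrable_on T \<and> integral T (\<lambda>x. vec (f x) :: real^1) = vec b"
      for f :: "real^'m::_ \<Rightarrow> real" and T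
      unfolding absolutely_integrable_on_1_iff integral_on_1_eq by (auto simp: vec_eq_iff)
    have "(\<lambda>x. \<bar>det (matrix (g' x))\<bar> *\<^sub>R (vec (h (g x)) :: real^1)) = (\<lambda>x. vec (k x))"
      by (auto simp: k_def vec_eq_iff)
    then show ?thesis
      unfolding vec1
      using has_absolute_integral_change_of_variables[of S g g' "\<lambda>y. vec (h y) :: real^1" "vec b"]
        S der inj by (auto intro: has_derivative_at_withinI)
  qed
  have finite_case: "(\<integral>\<^sup>+x\<in>T. ennreal (f x) \<partial>lborel) = ennreal (integral T f)"
    if "f absolutely_integrable_on T" "\<And>x. 0 \<le> f x" for f :: "real^'m::_ \<Rightarrow> real" and T
    using that 
    by (intro nn_integral_has_integral_lebesgue' integrable_integral)
      (auto simp: absolutely_integrable_on_def)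
  have fin_iff: "f absolutely_integrable_on T"
    if "(\<lambda>x. indicator T x * f x) \<in> borel_measurable borel" "\<And>x. 0 \<le> f x"
      "(\<integral>\<^sup>+x\<in>T. ennreal (f x) \<partial>lborel) < \<infinity>" for f :: "real^'m::_ \<Rightarrow> real" and T
  proof -
    have "(\<integral>\<^sup>+x. ennreal (indicator T x * f x) \<partial>lborel) = (\<integral>\<^sup>+x\<in>T. ennreal (f x) \<partial>lborel)"
      by (intro nn_integral_cong) (auto simp: indicator_def)
    then have "integrable lborel (\<lambda>x. indicator T x * f x)"
      using that by (intro integrableI_nonneg) auto
    then show ?thesis
      by (simp add: set_integrable_def integrable_completion)
  qed
  show ?thesis
  proof (cases "(\<integral>\<^sup>+y\<in>g ` S. ennreal (h y) \<partial>lborel) < \<infinity> \<or> (\<integral>\<^sup>+x\<in>S. ennreal (k x) \<partial>lborel) < \<infinity>")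
    case True
    have "(\<lambda>y. indicator (g ` S) y * h y) \<in> borel_measurable borel"
      using gS h by measurable
    then have "h absolutely_integrable_on (g ` S) \<or> k absolutely_integrable_on S"
      using True fin_iff[of "g ` S" h] fin_iff[of S k] nonneg k_nonneg h' by (auto simp: k_def)
    then have "h absolutely_integrable_on (g ` S)" "k absolutely_integrable_on S"
      "integral S k = integral (g ` S) h"
      using cov by blast+
    then show ?thesis
      using finite_case nonneg k_nonneg by (simp flip: k_def)
  next
    case False
    then show ?thesis
      by (simp add: k_def less_top[symmetric])
  qed
qed

lemma vec3_Basis: "(Basis :: (real^3) set) = {axis 1 1, axis 2 1, axis 3 1}"
  by (auto simp: Basis_vec_def UNIV_3)

text \<open>
  The coordinates \<open>(x, y, t)\<close> identify \<open>heis\<close> with \<open>real^3\<close>, where determinants and the change of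
  variables live. The identification maps boxes to boxes of the same volume, hence preserves
  Lebesgue measure.
\<close>

definition heis_of_vec :: "real^3 \<Rightarrow> heis" where
  "heis_of_vec v = (Complex (v $ 1) (v $ 2), v $ 3)"

definition vec_of_heis :: "heis \<Rightarrow> real^3" where
  "vec_of_heis p = vector [Re (fst p), Im (fst p), snd p]"

lemma heis_of_vec_of_heis [simp]: "heis_of_vec (vec_of_heis p) = p"
  by (simp add: heis_of_vec_def vec_of_heis_def)

lemma vec_of_heis_of_vec [simp]: "vec_of_heis (heis_of_vec v) = v"
  by (simp add: heis_of_vec_def vec_of_heis_def vec_eq_iff forall_3)

lemma bounded_linear_heis_of_vec: "bounded_linear heis_of_vec"
  unfolding linear_conv_bounded_linear[symmetric]
  by (rule linearI) (auto simp: heis_of_vec_def complex_eq_iff)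

lemma bounded_linear_vec_of_heis: "bounded_linear vec_of_heis"
  unfolding linear_conv_bounded_linear[symmetric]
  by (rule linearI) (auto simp: vec_of_heis_def vec_eq_iff forall_3)

lemma heis_Basis: "(Basis :: heis set) = {(1, 0), (\<i>, 0), (0, 1)}"
  by (auto simp: Basis_prod_def Basis_complex_def)

lemma distr_lborel_heis_of_vec: "distr lborel borel heis_of_vec = lborel"
proof (rule lborel_eqI[symmetric])
  have meas: "heis_of_vec \<in> borel_measurable borel"
    by (intro borel_measurable_continuous_onI bounded_linear.continuous_on[OF bounded_linear_heis_of_vec] continuous_on_id)
  fix l u :: heis assume le: "\<And>b. b \<in> Basis \<Longrightarrow> l \<bullet> b \<le> u \<bullet> b"
  have "heis_of_vec -` box l u = box (vec_of_heis l) (vec_of_heis u)"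
    by (auto simp: box_def heis_Basis vec3_Basis heis_of_vec_def vec_of_heis_def forall_3
       inner_axis inner_complex_def inner_prod_def)
  then have "emeasure (distr lborel borel heis_of_vec) (box l u) =
      emeasure lborel (box (vec_of_heis l) (vec_of_heis u))"
    using meas by (simp add: emeasure_distr)
  also have "\<dots> = (\<Prod>b\<in>Basis. (vec_of_heis u - vec_of_heis l) \<bullet> b)"
    using le[of "(1, 0)"] le[of "(\<i>, 0)"] le[of "(0, 1)"] by (intro emeasure_lborel_box)
      (auto simp: heis_Basis vec3_Basis vec_of_heis_def forall_3 inner_axis inner_complex_def inner_prod_def)
  also have "\<dots> = (\<Prod>b\<in>Basis. (u - l) \<bullet> b)"
    by (simp add: heis_Basis vec3_Basis vec_of_heis_def inner_axis axis_eq_axis inner_complex_def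
        inner_prod_def)
  finally show "emeasure (distr lborel borel heis_of_vec) (box l u) = (\<Prod>b\<in>Basis. (u - l) \<bullet> b)" .
qed simp

lemma nn_integral_lborel_heis:
  assumes "F \<in> borel_measurable borel"
  shows "(\<integral>\<^sup>+p. F p \<partial>(lborel :: heis measure)) = (\<integral>\<^sup>+v. F (heis_of_vec v) \<partial>lborel)"
proof -
  have "heis_of_vec \<in> borel_measurable borel"
    by (intro borel_measurable_continuous_onI bounded_linear.continuous_on[OF bounded_linear_heis_of_vec] continuous_on_id)
  then show ?thesis
    using assms by (subst distr_lborel_heis_of_vec[symmetric], subst nn_integral_distr) auto
qed

definition heis_matrix :: "(heis \<Rightarrow> heis) \<Rightarrow> real^3^3" where
  "heis_matrix A = matrix (vec_of_heis \<circ> A \<circ> heis_of_vec)"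

lemma nn_integral_change_of_variables_heis:
  fixes g :: "heis \<Rightarrow> heis" and h :: "heis \<Rightarrow> real"
  assumes S: "open S" and gS: "open (g ` S)"
    and der: "\<And>x. x \<in> S \<Longrightarrow> (g has_derivative g' x) (at x)"
    and inj: "inj_on g S"
    and J: "\<And>x. x \<in> S \<Longrightarrow> \<bar>det (heis_matrix (g' x))\<bar> = J x"
    and nonneg: "\<And>y. 0 \<le> h y" and h: "h \<in> borel_measurable borel"
    and h': "(\<lambda>x. indicator S x * (J x * h (g x))) \<in> borel_measurable borel"
  shows "(\<integral>\<^sup>+y\<in>g ` S. ennreal (h y) \<partial>lborel) = (\<integral>\<^sup>+x\<in>S. ennreal (J x * h (g x)) \<partial>lborel)"
proof -
  define T where "T = vec_of_heis ` S"
  define k where "k = vec_of_heis \<circ> g \<circ> heis_of_vec"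
  define k' where "k' v = vec_of_heis \<circ> g' (heis_of_vec v) \<circ> heis_of_vec" for v
  have cont: "continuous_on UNIV heis_of_vec"
    by (intro bounded_linear.continuous_on[OF bounded_linear_heis_of_vec] continuous_on_id)
  have meas [measurable]: "heis_of_vec \<in> borel_measurable borel"
    by (rule borel_measurable_continuous_onI[OF cont])
  have T_iff: "v \<in> T \<longleftrightarrow> heis_of_vec v \<in> S" for v
    by (auto simp: T_def image_iff) (metis vec_of_heis_of_vec)
  have kT_iff: "v \<in> k ` T \<longleftrightarrow> heis_of_vec v \<in> g ` S" for v
    by (auto simp: k_def T_def image_iff) (metis vec_of_heis_of_vec)
  have "open (heis_of_vec -` S)" "open (heis_of_vec -` (g ` S))"
    using cont S gS by (auto simp: open_vimage)
  moreover have "heis_of_vec -` S = T" "heis_of_vec -` (g ` S) = k ` T"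
    using T_iff kT_iff by (intro set_eqI; simp)+
  ultimately have T: "open T" "open (k ` T)"
    by simp_all
  have k': "(k has_derivative k' v) (at v)" if "v \<in> T" for v
    unfolding k_def k'_def
    using that T_iff
    by (intro diff_chain_at bounded_linear_imp_has_derivative bounded_linear_heis_of_vec
         bounded_linear_vec_of_heis der) auto
  have inj_k: "inj_on k T"
    using inj by (intro inj_onI) (metis T_iff heis_of_vec_of_heis inj_onD k_def o_apply vec_of_heis_of_vec)
  have J': "\<bar>det (matrix (k' v))\<bar> = J (heis_of_vec v)" if "v \<in> T" for v
    using J[of "heis_of_vec v"] that by (simp add: T_iff k'_def heis_matrix_def)
  have "(\<lambda>v. indicator S (heis_of_vec v) * (J (heis_of_vec v) * h (g (heis_of_vec v)))) \<in> borel_measurable borel"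
    using measurable_compose[OF meas h'] .
  moreover have "indicator S (heis_of_vec v) * (J (heis_of_vec v) * h (g (heis_of_vec v))) =
    indicator T v * (\<bar>det (matrix (k' v))\<bar> * h (heis_of_vec (k v)))" for v
    using J'[of v] T_iff[of v] by (auto simp: indicator_def k_def)
  ultimately have meas': "(\<lambda>v. indicator T v * (\<bar>det (matrix (k' v))\<bar> * h (heis_of_vec (k v)))) \<in> borel_measurable borel"
    by simp
  have "(\<integral>\<^sup>+y\<in>g ` S. ennreal (h y) \<partial>lborel) = (\<integral>\<^sup>+v\<in>k ` T. ennreal (h (heis_of_vec v)) \<partial>lborel)"
  proof (subst nn_integral_lborel_heis)
    have "g ` S \<in> sets borel"
      using gS by simp
    then show "(\<lambda>y. ennreal (h y) * indicator (g ` S) y) \<in> borel_measurable borel"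
      using h by measurable
  qed (auto simp: indicator_def kT_iff)
  also have "\<dots> = (\<integral>\<^sup>+v\<in>T. ennreal (\<bar>det (matrix (k' v))\<bar> * h (heis_of_vec (k v))) \<partial>lborel)"
    by (rule nn_integral_change_of_variables_cart) (use T k' inj_k nonneg meas' h in auto)
  also have "\<dots> = (\<integral>\<^sup>+v. ennreal (indicator S (heis_of_vec v) * (J (heis_of_vec v) * h (g (heis_of_vec v)))) \<partial>lborel)"
    using J' T_iff by (intro nn_integral_cong) (auto simp: indicator_def k_def)
  also have "\<dots> = (\<integral>\<^sup>+x. ennreal (indicator S x * (J x * h (g x))) \<partial>lborel)"
    using h' by (subst nn_integral_lborel_heis) auto
  also have "\<dots> = (\<integral>\<^sup>+x\<in>S. ennreal (J x * h (g x)) \<partial>lborel)"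
    by (intro nn_integral_cong) (auto simp: indicator_def)
  finally show ?thesis .
qed

section \<open>Linear algebra of the contact form\<close>

lemma contact_form_add_scale:
  "contact_form p (a *\<^sub>R v + b *\<^sub>R w) = a * contact_form p v + b * contact_form p w"
  by (simp add: contact_form_def algebra_simps)

lemma contact_form_frame [simp]:
  "contact_form p (X_field p) = 0" "contact_form p (Y_field p) = 0" "contact_form p (0, 1) = 1"
  by (simp_all add: contact_form_def X_field_def Y_field_def)

text \<open>
  The projection \<open>fst\<close> is an isometry from each horizontal plane onto the complex numbers, taking
  \<open>X, Y\<close> to \<open>1, \<i>\<close>. A horizontal vector is therefore treated as the complex number \<open>fst v\<close>.
\<close>

lemma horizontal_eq_frame:
  assumes "contact_form p v = 0"
  shows "v = Re (fst v) *\<^sub>R X_field p + Im (fst v) *\<^sub>R Y_field p"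
  using assms by (simp add: contact_form_def X_field_def Y_field_def prod_eq_iff complex_eq_iff algebra_simps)

text \<open>
  The second summand is \<open>d\<omega>/2\<close>, that is, \<open>2 dx \<and> dy\<close>. It arises because the coefficients of \<open>\<omega>\<close> depend on
  the base point.
\<close>

lemma has_derivative_contact_form:
  assumes F: "(F has_derivative F') (at p within S)" and G: "(G has_derivative G') (at p within S)"
  shows "((\<lambda>q. contact_form (F q) (G q)) has_derivative
    (\<lambda>u. contact_form (F p) (G' u) +
      2 * (Re (fst (F' u)) * Im (fst (G p)) - Im (fst (F' u)) * Re (fst (G p))))) (at p within S)"
  unfolding contact_form_def
  by (rule derivative_eq_intros F G | simp)+ (simp add: algebra_simps fun_eq_iff)

text \<open>
  If \<open>a, b\<close> span the tangent plane of the patch, then \<open>\<omega>(a) b - \<omega>(b) a\<close> is a horizontal vector in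
  that plane; the horizontal normal is this vector turned by a right angle. In this form the area
  element is easy to transport by a contact map, which multiplies \<open>\<omega>\<close> by a scalar.
\<close>

lemma horizontal_normal_norm:
  fixes \<sigma> :: "real \<times> real \<Rightarrow> heis"
  defines "a \<equiv> \<lambda>w. frechet_derivative \<sigma> (at w) (1, 0)" and "b \<equiv> \<lambda>w. frechet_derivative \<sigma> (at w) (0, 1)"
  shows "norm (horizontal_normal \<sigma> w) =
    norm (fst (contact_form (\<sigma> w) (a w) *\<^sub>R b w - contact_form (\<sigma> w) (b w) *\<^sub>R a w))"
  by (simp add: a_def b_def horizontal_normal_def contact_form_def Let_def norm_prod_def norm_complex_def)
     (simp add: power2_eq_square algebra_simps)

text \<open>
  In the frames \<open>X, Y, \<partial>\<^sub>t\<close> at \<open>p\<close> and \<open>q\<close>, both of determinant one, \<open>A\<close> is block triangular: it maps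
  horizontal vectors to horizontal ones and \<open>\<partial>\<^sub>t\<close> to \<open>l \<partial>\<^sub>t\<close> modulo horizontal vectors.
\<close>

lemma det_heis_matrix_contact:
  assumes "linear A" and contact: "\<And>v. contact_form q (A v) = l * contact_form p v"
  defines "z \<equiv> fst (A (X_field p))" and "w \<equiv> fst (A (Y_field p))"
  shows "det (heis_matrix A) = l * (Re z * Im w - Im z * Re w)"
proof -
  define e1 where "e1 = A (1, 0)"
  define e2 where "e2 = A (\<i>, 0)"
  define e3 where "e3 = A (0, 1)"
  have "X_field p = (1, 0) + (2 * Im (fst p)) *\<^sub>R (0, 1)"
    by (simp add: X_field_def)
  then have z: "z = fst e1 + (2 * Im (fst p)) *\<^sub>R fst e3"
    by (simp only: z_def e1_def e3_def linear_add[OF \<open>linear A\<close>] linear_scale[OF \<open>linear A\<close>] fst_add fst_scaleR)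
  have "Y_field p = (\<i>, 0) + (- 2 * Re (fst p)) *\<^sub>R (0, 1)"
    by (simp add: Y_field_def)
  then have w: "w = fst e2 + (- 2 * Re (fst p)) *\<^sub>R fst e3"
    by (simp only: w_def e2_def e3_def linear_add[OF \<open>linear A\<close>] linear_scale[OF \<open>linear A\<close>] fst_add fst_scaleR)
  \<comment> \<open>The contact condition determines the third coordinates of the three columns.\<close>
  have t: "snd e1 = - 2 * Im (fst p) * l - 2 * Re (fst q) * Im (fst e1) + 2 * Im (fst q) * Re (fst e1)"
    "snd e2 = 2 * Re (fst p) * l - 2 * Re (fst q) * Im (fst e2) + 2 * Im (fst q) * Re (fst e2)"
    "snd e3 = l - 2 * Re (fst q) * Im (fst e3) + 2 * Im (fst q) * Re (fst e3)"
    using contact[of "(1, 0)"] contact[of "(\<i>, 0)"] contact[of "(0, 1)"]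
    by (simp_all add: e1_def e2_def e3_def contact_form_def algebra_simps)
  have basis: "heis_of_vec (axis 1 1) = (1, 0)" "heis_of_vec (axis 2 1) = (\<i>, 0)"
    "heis_of_vec (axis 3 1) = (0, 1)"
    by (simp_all add: heis_of_vec_def axis_def complex_eq_iff)
  have "det (heis_matrix A) =
      Re (fst e1) * Im (fst e2) * snd e3 + Re (fst e2) * Im (fst e3) * snd e1 +
      Re (fst e3) * Im (fst e1) * snd e2 - Re (fst e1) * Im (fst e3) * snd e2 -
      Re (fst e2) * Im (fst e1) * snd e3 - Re (fst e3) * Im (fst e2) * snd e1"
    by (simp add: det_3 heis_matrix_def matrix_def basis vec_of_heis_def e1_def e2_def e3_def)
  also have "\<dots> = l * (Re z * Im w - Im z * Re w)"
    by (simp add: t z w algebra_simps)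
  finally show ?thesis .
qed

section \<open>The differential of a contact diffeomorphism\<close>

locale contact_diffeo =
  fixes \<Omega> \<Omega>' :: "heis set" and f :: "heis \<Rightarrow> heis" and l :: "heis \<Rightarrow> real"
  assumes open_source: "open \<Omega>" and open_target: "open \<Omega>'"
    and diffeo: "C2_diffeomorphism f \<Omega> \<Omega>'"
    and conformal: "conformal_factor f \<Omega> l"
    and factor_pos: "\<And>p. p \<in> \<Omega> \<Longrightarrow> l p > 0"
begin

abbreviation Df :: "heis \<Rightarrow> heis \<Rightarrow> heis" where
  "Df p \<equiv> frechet_derivative f (at p)"

abbreviation Zf :: "heis \<Rightarrow> complex" where
  "Zf \<equiv> Z_deriv (\<lambda>q. fst (f q))"

abbreviation Zbarf :: "heis \<Rightarrow> complex" where
  "Zbarf \<equiv> Zbar_deriv (\<lambda>q. fst (f q))"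

lemma Df: "p \<in> \<Omega> \<Longrightarrow> (f has_derivative Df p) (at p)"
  using diffeo unfolding C2_diffeomorphism_def C2_on_def
  by (metis frechet_derivative_at)

lemma Df_linear: "p \<in> \<Omega> \<Longrightarrow> linear (Df p)"
  using Df has_derivative_linear by blast

lemma contact_Df: "p \<in> \<Omega> \<Longrightarrow> contact_form (f p) (Df p v) = l p * contact_form p v"
  using conformal unfolding conformal_factor_def by blast

lemma factor_eq: "p \<in> \<Omega> \<Longrightarrow> l p = contact_form (f p) (Df p (0, 1))"
  by (simp add: contact_Df)

lemma Df_C1:
  obtains f' :: "heis \<Rightarrow> heis \<Rightarrow>\<^sub>L heis" and f'' :: "heis \<Rightarrow> heis \<Rightarrow>\<^sub>L heis \<Rightarrow>\<^sub>L heis"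
  where "\<And>p. p \<in> \<Omega> \<Longrightarrow> blinfun_apply (f' p) = Df p"
    and "\<And>p. p \<in> \<Omega> \<Longrightarrow> (f' has_derivative f'' p) (at p)"
  using diffeo unfolding C2_diffeomorphism_def C2_on_def
  by (metis frechet_derivative_at)

text \<open>
  This is \<open>f\<^sup>*d\<omega> = d(\<lambda>\<omega>)\<close> evaluated on \<open>X, Y\<close>: as \<open>\<omega>\<close> vanishes on both, the right-hand side is
  \<open>\<lambda> d\<omega>(X, Y)\<close>, so \<open>f\<close> multiplies horizontal area by \<open>\<lambda>\<close>. Concretely the contact condition is
  differentiated in the direction \<open>u\<close> and antisymmetrised in \<open>u, v\<close>, which removes the second
  derivatives of \<open>f\<close>.
\<close>

lemma horizontal_area:
  assumes p: "p \<in> \<Omega>"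
  defines "z \<equiv> fst (Df p (X_field p))" and "w \<equiv> fst (Df p (Y_field p))"
  shows "Re z * Im w - Im z * Re w = l p"
proof -
  obtain f' f'' where f': "\<And>p. p \<in> \<Omega> \<Longrightarrow> blinfun_apply (f' p) = Df p"
    and f'': "\<And>p. p \<in> \<Omega> \<Longrightarrow> (f' has_derivative blinfun_apply (f'' p)) (at p)"
    using Df_C1 by blast
  have der: "((\<lambda>q. f' q v) has_derivative (\<lambda>u. f'' p u v)) (at p)" for v
    by (rule bounded_linear.has_derivative[OF blinfun.bounded_linear_left f''[OF p]])
  \<comment> \<open>\<open>L\<close> is the conformal factor \<open>l\<close> written in terms of \<open>Df\<close>, a form in which it is visibly
    differentiable.\<close>
  define L where "L q = contact_form (f q) (f' q (0, 1))" for q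
  obtain L' where L': "(L has_derivative L') (at p)"
    unfolding L_def using has_derivative_contact_form[OF Df[OF p] der] by blast
  have Lp: "L p = l p"
    using p by (simp add: L_def f' factor_eq)
  have derivs_eq: "contact_form (f p) (f'' p u v) +
        2 * (Re (fst (Df p u)) * Im (fst (Df p v)) - Im (fst (Df p u)) * Re (fst (Df p v))) =
      l p * (2 * (Re (fst u) * Im (fst v) - Im (fst u) * Re (fst v))) + L' u * contact_form p v" for u v
  proof -
    have "((\<lambda>q. contact_form (f q) (f' q v)) has_derivative (\<lambda>u. contact_form (f p) (f'' p u v) +
        2 * (Re (fst (Df p u)) * Im (fst (Df p v)) - Im (fst (Df p u)) * Re (fst (Df p v))))) (at p)"
      using has_derivative_contact_form[OF Df[OF p] der[of v]] p by (simp add: f')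
    moreover have "((\<lambda>q. L q * contact_form q v) has_derivative
        (\<lambda>u. l p * (2 * (Re (fst u) * Im (fst v) - Im (fst u) * Re (fst v))) + L' u * contact_form p v)) (at p)"
      using has_derivative_mult[OF L' has_derivative_contact_form[OF has_derivative_ident has_derivative_const[of v]]]
      by (simp add: Lp contact_form_def)
    then have "((\<lambda>q. contact_form (f q) (f' q v)) has_derivative
        (\<lambda>u. l p * (2 * (Re (fst u) * Im (fst v) - Im (fst u) * Re (fst v))) + L' u * contact_form p v)) (at p)"
      by (rule has_derivative_transform_within_open[OF _ open_source p])
         (simp add: L_def f' contact_Df)
    ultimately show ?thesis
      using fun_cong[OF has_derivative_unique, of _ _ p _ u] by blast
  qed
  have "f'' p (X_field p) (Y_field p) = f'' p (Y_field p) (X_field p)"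
    using symmetric_second_derivative[OF open_source p _ f''[OF p], of f] Df f' by simp
  then have "4 * (Re z * Im w - Im z * Re w) = 4 * l p"
    using derivs_eq[of "X_field p" "Y_field p"] derivs_eq[of "Y_field p" "X_field p"]
    by (simp add: z_def w_def) (simp add: X_field_def Y_field_def algebra_simps)
  then show ?thesis by simp
qed

lemma det_Df: "p \<in> \<Omega> \<Longrightarrow> \<bar>det (heis_matrix (Df p))\<bar> = (l p)\<^sup>2"
  using det_heis_matrix_contact[OF Df_linear contact_Df] horizontal_area
  by (simp add: power2_eq_square)

lemma frechet_derivative_fst:
  assumes "p \<in> \<Omega>"
  shows "frechet_derivative (\<lambda>q. fst (f q)) (at p) v = fst (Df p v)"
  by (metis Df[OF assms] frechet_derivative_at has_derivative_fst)

lemma Zf_eq: "p \<in> \<Omega> \<Longrightarrow> Zf p = (fst (Df p (X_field p)) - \<i> * fst (Df p (Y_field p))) / 2"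
  and Zbarf_eq: "p \<in> \<Omega> \<Longrightarrow> Zbarf p = (fst (Df p (X_field p)) + \<i> * fst (Df p (Y_field p))) / 2"
  by (simp_all add: Z_deriv_def Zbar_deriv_def frechet_derivative_fst)

text \<open>
  A real-linear map \<open>\<zeta> \<mapsto> \<alpha>\<zeta> + \<beta> cnj \<zeta>\<close> of the complex plane has determinant \<open>\<bar>\<alpha>\<bar>\<^sup>2 - \<bar>\<beta>\<bar>\<^sup>2\<close>; on horizontal
  planes \<open>Df\<close> is such a map, with coefficients \<open>Zf\<close> and \<open>Zbarf\<close>.
\<close>

lemma factor_eq_norms:
  assumes "p \<in> \<Omega>"
  shows "(norm (Zf p) - norm (Zbarf p)) * (norm (Zf p) + norm (Zbarf p)) = l p"
proof -
  have "(cmod ((z - \<i> * w) / 2))\<^sup>2 - (cmod ((z + \<i> * w) / 2))\<^sup>2 = Re z * Im w - Im z * Re w" for z w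
    unfolding cmod_power2 by (simp add: power2_eq_square field_simps)
  then have "(norm (Zf p))\<^sup>2 - (norm (Zbarf p))\<^sup>2 = l p"
    using assms by (simp add: Zf_eq Zbarf_eq horizontal_area)
  then show ?thesis
    by (simp add: power2_eq_square algebra_simps)
qed

lemma norm_Zbarf_less: "p \<in> \<Omega> \<Longrightarrow> norm (Zbarf p) < norm (Zf p)"
  using factor_eq_norms[of p] factor_pos[of p]
  by (smt (verit) mult_nonneg_nonneg mult_nonpos_nonneg norm_ge_zero)

lemma Df_horizontal:
  assumes p: "p \<in> \<Omega>" and v: "contact_form p v = 0"
  shows "fst (Df p v) = Zf p * fst v + Zbarf p * cnj (fst v)"
proof -
  have "fst (Df p v) = Re (fst v) *\<^sub>R fst (Df p (X_field p)) + Im (fst v) *\<^sub>R fst (Df p (Y_field p))"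
    by (subst horizontal_eq_frame[OF v])
       (simp add: linear_add[OF Df_linear[OF p]] linear_scale[OF Df_linear[OF p]])
  then show ?thesis
    by (simp add: Zf_eq Zbarf_eq p complex_eq_iff field_simps)
qed

lemma norm_Df_horizontal:
  assumes "p \<in> \<Omega>" "contact_form p v = 0"
  shows "(norm (Zf p) - norm (Zbarf p)) * norm (fst v) \<le> norm (fst (Df p v))"
    and "norm (fst (Df p v)) \<le> (norm (Zf p) + norm (Zbarf p)) * norm (fst v)"
proof -
  have "norm (Zf p * fst v) = norm (Zf p) * norm (fst v)"
    "norm (Zbarf p * cnj (fst v)) = norm (Zbarf p) * norm (fst v)"
    by (simp_all add: norm_mult)
  then show "(norm (Zf p) - norm (Zbarf p)) * norm (fst v) \<le> norm (fst (Df p v))"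
    "norm (fst (Df p v)) \<le> (norm (Zf p) + norm (Zbarf p)) * norm (fst v)"
    using norm_diff_ineq[of "Zf p * fst v" "Zbarf p * cnj (fst v)"]
      norm_triangle_ineq[of "Zf p * fst v" "Zbarf p * cnj (fst v)"]
    by (simp_all add: Df_horizontal[OF assms] algebra_simps)
qed

text \<open>
  Applying \<open>Df\<close> to \<open>\<omega>(a) b - \<omega>(b) a\<close> commutes with forming it, except that \<open>\<omega>\<close> picks up the factor
  \<open>l\<close>; the vector is horizontal, so its length changes by a factor between \<open>\<bar>Zf\<bar> - \<bar>Zbarf\<bar>\<close> and
  \<open>\<bar>Zf\<bar> + \<bar>Zbarf\<bar>\<close>.
\<close>

lemma horizontal_normal_compose:
  fixes \<sigma> :: "real \<times> real \<Rightarrow> heis"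
  assumes \<sigma>: "\<sigma> differentiable at w" and p: "\<sigma> w \<in> \<Omega>"
  shows "l (\<sigma> w) * (norm (Zf (\<sigma> w)) - norm (Zbarf (\<sigma> w))) * norm (horizontal_normal \<sigma> w)
           \<le> norm (horizontal_normal (f \<circ> \<sigma>) w)"
    and "norm (horizontal_normal (f \<circ> \<sigma>) w)
           \<le> l (\<sigma> w) * (norm (Zf (\<sigma> w)) + norm (Zbarf (\<sigma> w))) * norm (horizontal_normal \<sigma> w)"
proof -
  define p where "p = \<sigma> w"
  have p: "p \<in> \<Omega>" using p by (simp add: p_def)
  define a where "a = frechet_derivative \<sigma> (at w) (1, 0)"
  define b where "b = frechet_derivative \<sigma> (at w) (0, 1)"
  define v where "v = contact_form p a *\<^sub>R b - contact_form p b *\<^sub>R a"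
  have v: "contact_form p v = 0"
    using contact_form_add_scale[of p "contact_form p a" b "- contact_form p b" a] by (simp add: v_def)
  have D: "frechet_derivative (f \<circ> \<sigma>) (at w) = Df p \<circ> frechet_derivative \<sigma> (at w)"
    using frechet_derivative_compose[of \<sigma> w f] Df[OF p] \<sigma> by (simp add: p_def differentiable_def)
       blast
  have "norm (horizontal_normal (f \<circ> \<sigma>) w) = norm (fst (l p *\<^sub>R Df p v))"
    unfolding horizontal_normal_norm
    by (simp add: D contact_Df[OF p] v_def linear_diff[OF Df_linear[OF p]] linear_scale[OF Df_linear[OF p]]
        scaleR_diff_right flip: p_def a_def b_def)
  then have N: "norm (horizontal_normal (f \<circ> \<sigma>) w) = l p * norm (fst (Df p v))"
    using factor_pos[OF p] by simp
  have N0: "norm (horizontal_normal \<sigma> w) = norm (fst v)"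
    unfolding horizontal_normal_norm by (simp add: v_def p_def a_def b_def)
  show "l (\<sigma> w) * (norm (Zf (\<sigma> w)) - norm (Zbarf (\<sigma> w))) * norm (horizontal_normal \<sigma> w)
           \<le> norm (horizontal_normal (f \<circ> \<sigma>) w)"
    "norm (horizontal_normal (f \<circ> \<sigma>) w)
           \<le> l (\<sigma> w) * (norm (Zf (\<sigma> w)) + norm (Zbarf (\<sigma> w))) * norm (horizontal_normal \<sigma> w)"
    using norm_Df_horizontal[OF p v] factor_pos[OF p] unfolding N N0 p_def[symmetric]
    by (simp_all add: mult.assoc)
qed

lemma continuous_f: "continuous_on \<Omega> f"
  using Df by (meson has_derivative_continuous continuous_at_imp_continuous_on)

lemma continuous_Df:
  assumes "continuous_on \<Omega> v"
  shows "continuous_on \<Omega> (\<lambda>p. Df p (v p))"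
proof -
  obtain f' f'' where f': "\<And>p. p \<in> \<Omega> \<Longrightarrow> blinfun_apply (f' p) = Df p"
    and f'': "\<And>p. p \<in> \<Omega> \<Longrightarrow> (f' has_derivative blinfun_apply (f'' p)) (at p)"
    using Df_C1 by blast
  have "continuous_on \<Omega> f'"
    using f'' by (meson has_derivative_continuous continuous_at_imp_continuous_on)
  then have "continuous_on \<Omega> (\<lambda>p. f' p (v p))"
    using assms by (intro continuous_intros)
  then show ?thesis
    by (rule continuous_on_eq) (simp add: f')
qed

lemma continuous_factor: "continuous_on \<Omega> l"
proof -
  have "continuous_on \<Omega> (\<lambda>p. contact_form (f p) (Df p (0, 1)))"
    unfolding contact_form_def by (intro continuous_intros continuous_f continuous_Df)
  then show ?thesis
    by (rule continuous_on_eq) (simp add: factor_eq)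
qed

lemma continuous_Zf: "continuous_on \<Omega> Zf" and continuous_Zbarf: "continuous_on \<Omega> Zbarf"
proof -
  have *: "continuous_on \<Omega> (\<lambda>p. (fst (Df p (X_field p)) - \<i> * fst (Df p (Y_field p))) / 2)"
    "continuous_on \<Omega> (\<lambda>p. (fst (Df p (X_field p)) + \<i> * fst (Df p (Y_field p))) / 2)"
    unfolding X_field_def Y_field_def by (intro continuous_intros continuous_Df; simp)+
  show "continuous_on \<Omega> Zf"
    using *(1) by (rule continuous_on_eq) (simp add: Zf_eq)
  show "continuous_on \<Omega> Zbarf"
    using *(2) by (rule continuous_on_eq) (simp add: Zbarf_eq)
qed

end

section \<open>Surfaces under diffeomorphisms\<close>

lemma C2_diffeomorphism_homeomorphism:
  assumes "C2_diffeomorphism g \<Omega> \<Omega>'"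
  shows "homeomorphism \<Omega> \<Omega>' g (inv_into \<Omega> g)"
proof (rule homeomorphismI)
  have bij: "bij_betw g \<Omega> \<Omega>'"
    using assms by (simp add: C2_diffeomorphism_def)
  show "continuous_on \<Omega> g" "continuous_on \<Omega>' (inv_into \<Omega> g)"
    using assms by (simp_all add: C2_diffeomorphism_def C2_on_imp_continuous_on)
  show "g ` \<Omega> \<subseteq> \<Omega>'" "inv_into \<Omega> g ` \<Omega>' \<subseteq> \<Omega>"
    using bij by (auto simp: bij_betw_def inv_into_into)
  show "inv_into \<Omega> g (g x) = x" if "x \<in> \<Omega>" for x
    using bij that by (simp add: bij_betw_inv_into_left)
  show "g (inv_into \<Omega> g y) = y" if "y \<in> \<Omega>'" for y
    using bij that by (simp add: bij_betw_inv_into_right)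
qed

text \<open>
  Only \<open>C2_on\<close> of the twofold inverse needs an argument: it agrees with \<open>g\<close> on \<open>\<Omega>\<close>, and openness
  makes that enough for its derivatives.
\<close>

lemma C2_diffeomorphism_inverse:
  assumes g: "C2_diffeomorphism g \<Omega> \<Omega>'" and \<Omega>: "open \<Omega>"
  shows "C2_diffeomorphism (inv_into \<Omega> g) \<Omega>' \<Omega>"
proof -
  have bij: "bij_betw g \<Omega> \<Omega>'"
    using g by (simp add: C2_diffeomorphism_def)
  have bij': "bij_betw (inv_into \<Omega> g) \<Omega>' \<Omega>"
    using bij by (rule bij_betw_inv_into)
  have eq: "inv_into \<Omega>' (inv_into \<Omega> g) x = g x" if "x \<in> \<Omega>" for x
    using that bij bij' by (metis bij_betw_def bij_betw_inv_into_left imageI inv_into_f_eq)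
  from g obtain f' :: "heis \<Rightarrow> heis \<Rightarrow>\<^sub>L heis" and f'' :: "heis \<Rightarrow> heis \<Rightarrow>\<^sub>L heis \<Rightarrow>\<^sub>L heis"
    where *: "\<And>x. x \<in> \<Omega> \<Longrightarrow> (g has_derivative f' x) (at x)"
      "\<And>x. x \<in> \<Omega> \<Longrightarrow> (f' has_derivative f'' x) (at x)" "continuous_on \<Omega> f''"
    unfolding C2_diffeomorphism_def C2_on_def by blast
  have "(inv_into \<Omega>' (inv_into \<Omega> g) has_derivative f' x) (at x)" if "x \<in> \<Omega>" for x
    by (rule has_derivative_transform_within_open[OF *(1)[OF that] \<Omega> that]) (simp add: eq)
  then have "C2_on (inv_into \<Omega>' (inv_into \<Omega> g)) \<Omega>"
    unfolding C2_on_def using * by blast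
  then show ?thesis
    using g bij' by (simp add: C2_diffeomorphism_def)
qed

lemma regular_patch_image:
  assumes g: "C2_diffeomorphism g \<Omega> \<Omega>'" and \<Omega>: "open \<Omega>" and S: "S \<subseteq> \<Omega>"
    and patch: "regular_patch S U \<sigma>"
  shows "regular_patch (g ` S) U (g \<circ> \<sigma>)"
proof -
  have hom: "homeomorphism \<Omega> \<Omega>' g (inv_into \<Omega> g)"
    by (rule C2_diffeomorphism_homeomorphism[OF g])
  have C2: "C2_on g \<Omega>" "C2_on (inv_into \<Omega> g) \<Omega>'"
    using g by (simp_all add: C2_diffeomorphism_def)
  have U: "open U" and \<sigma>: "C2_on \<sigma> U" and inj: "\<And>w. w \<in> U \<Longrightarrow> inj (frechet_derivative \<sigma> (at w))"
    and op: "openin (top_of_set S) (\<sigma> ` U)"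
    using patch by (auto simp: regular_patch_def)
  obtain h where h: "homeomorphism U (\<sigma> ` U) \<sigma> h"
    using patch by (auto simp: regular_patch_def)
  have \<sigma>U: "\<sigma> ` U \<subseteq> \<Omega>"
    using openin_imp_subset[OF op] S by blast
  have "inj (frechet_derivative (g \<circ> \<sigma>) (at w))" if w: "w \<in> U" for w
  proof -
    have p: "\<sigma> w \<in> \<Omega>" and q: "g (\<sigma> w) \<in> \<Omega>'"
      using \<sigma>U w homeomorphism_image1[OF hom] by auto
    have "inv_into \<Omega> g \<circ> g differentiable at (\<sigma> w)"
      using C2_on_imp_differentiable[OF C2(1) p] C2_on_imp_differentiable[OF C2(2) q]
      by (rule differentiable_chain_at)
    have "frechet_derivative (inv_into \<Omega> g \<circ> g) (at (\<sigma> w)) = frechet_derivative id (at (\<sigma> w))"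
      by (rule frechet_derivative_transform_within_open[OF _ \<Omega> p]) (fact, simp add: homeomorphism_apply1[OF hom])
    then have "frechet_derivative (inv_into \<Omega> g) (at (g (\<sigma> w))) \<circ> frechet_derivative g (at (\<sigma> w)) = id"
      using frechet_derivative_compose[OF C2_on_imp_differentiable[OF C2(1) p] C2_on_imp_differentiable[OF C2(2) q]]
      by (simp add: frechet_derivative_id id_def)
    then have "inj (frechet_derivative g (at (\<sigma> w)))"
      by (metis inj_on_id inj_on_imageI2)
    then show ?thesis
      using inj[OF w]
      by (simp add: frechet_derivative_compose[OF C2_on_imp_differentiable[OF \<sigma> w] C2_on_imp_differentiable[OF C2(1) p]] inj_compose)
  qed
  moreover have "C2_on (g \<circ> \<sigma>) U"
    by (rule C2_on_compose[OF C2(1) \<sigma> \<sigma>U])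
  moreover have "openin (top_of_set (g ` S)) ((g \<circ> \<sigma>) ` U)"
    unfolding image_comp[symmetric]
    by (rule homeomorphism_imp_open_map[OF homeomorphism_of_subsets[OF hom S, of "g ` S"] op])
       (use S homeomorphism_image1[OF hom] in auto)
  moreover have "homeomorphism U ((g \<circ> \<sigma>) ` U) (g \<circ> \<sigma>) (h \<circ> inv_into \<Omega> g)"
    unfolding image_comp[symmetric]
    by (rule homeomorphism_compose[OF h homeomorphism_of_subsets[OF hom \<sigma>U, of "g ` \<sigma> ` U"]])
       (use \<sigma>U homeomorphism_image1[OF hom] in auto)
  ultimately show ?thesis
    using U by (auto simp: regular_patch_def)
qed

lemma patch_decomposition_image:
  assumes g: "C2_diffeomorphism g \<Omega> \<Omega>'" and \<Omega>: "open \<Omega>" "open \<Omega>'" and S: "S \<subseteq> \<Omega>"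
    and dec: "patch_decomposition S U \<sigma> B"
  shows "patch_decomposition (g ` S) U (\<lambda>n. g \<circ> \<sigma> n) (\<lambda>n. g ` B n)"
proof -
  have hom: "homeomorphism \<Omega> \<Omega>' g (inv_into \<Omega> g)"
    by (rule C2_diffeomorphism_homeomorphism[OF g])
  have B: "B n \<subseteq> \<Omega>" "B n \<in> sets borel" for n
    using dec S by (auto simp: patch_decomposition_def)
  have inj: "inj_on g \<Omega>"
    using g by (auto simp: C2_diffeomorphism_def bij_betw_def)
  have "g ` B n \<in> sets borel" for n
  proof -
    have "g ` B n = inv_into \<Omega> g -` B n \<inter> \<Omega>'"
      using B(1)[of n] hom by (force simp: homeomorphism_def)
    moreover have "inv_into \<Omega> g \<in> borel_measurable (restrict_space borel \<Omega>')"
      using hom by (intro borel_measurable_continuous_on_restrict) (simp add: homeomorphism_def)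
    from measurable_sets[OF this B(2)[of n]] have "inv_into \<Omega> g -` B n \<inter> \<Omega>' \<in> sets (restrict_space borel \<Omega>')"
      by (simp add: space_restrict_space)
    then have "inv_into \<Omega> g -` B n \<inter> \<Omega>' \<in> sets borel"
      using \<Omega>(2) by (subst (asm) sets_restrict_space_iff) auto
    ultimately show ?thesis by simp
  qed
  moreover have "disjoint_family (\<lambda>n. g ` B n)"
    using dec inj B(1) unfolding patch_decomposition_def disjoint_family_on_def
    by (metis image_empty inj_on_image_Int)
  moreover have "g ` B n \<subseteq> (g \<circ> \<sigma> n) ` U n" for n
    unfolding image_comp[symmetric] using dec by (intro image_mono) (simp add: patch_decomposition_def)
  moreover have "(\<Union>n. g ` B n) = g ` S"
    using dec by (auto simp: patch_decomposition_def)
  ultimately show ?thesis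
    using dec regular_patch_image[OF g \<Omega>(1) S] by (simp add: patch_decomposition_def)
qed

text \<open>
  Patch decompositions of \<open>S\<close> are carried to patch decompositions of \<open>g ` S\<close> with the same
  parameter domains, so a pointwise comparison of the integrands on parameters is enough. The
  supremum in \<open>surface_integral\<close> is estimated termwise.
\<close>

lemma surface_integral_le_image:
  assumes g: "C2_diffeomorphism g \<Omega> \<Omega>'" and \<Omega>: "open \<Omega>" "open \<Omega>'" and S: "S \<subseteq> \<Omega>"
    and le: "\<And>U \<sigma> w. regular_patch S U \<sigma> \<Longrightarrow> w \<in> U \<Longrightarrow>
      \<rho> (\<sigma> w) * norm (horizontal_normal \<sigma> w) \<le> \<rho>' (g (\<sigma> w)) * norm (horizontal_normal (g \<circ> \<sigma>) w)"
  shows "surface_integral S \<rho> \<le> surface_integral (g ` S) \<rho>'"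
  unfolding surface_integral_def
proof (rule SUP_least, clarify)
  fix U \<sigma> B assume dec: "patch_decomposition S U \<sigma> B"
  have inj: "inj_on g \<Omega>"
    using g by (auto simp: C2_diffeomorphism_def bij_betw_def)
  have "patch_integral \<rho> (U n) (\<sigma> n) (B n) \<le> patch_integral \<rho>' (U n) (g \<circ> \<sigma> n) (g ` B n)" for n
    unfolding patch_integral_def
  proof (rule nn_integral_mono)
    fix w
    have patch: "regular_patch S (U n) (\<sigma> n)"
      using dec by (simp add: patch_decomposition_def)
    show "ennreal (\<rho> (\<sigma> n w) * norm (horizontal_normal (\<sigma> n) w)) * indicator {w \<in> U n. \<sigma> n w \<in> B n} w
      \<le> ennreal (\<rho>' ((g \<circ> \<sigma> n) w) * norm (horizontal_normal (g \<circ> \<sigma> n) w)) *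
          indicator {w \<in> U n. (g \<circ> \<sigma> n) w \<in> g ` B n} w"
      using le[OF patch, of w] by (auto simp: indicator_def intro!: ennreal_leI)
  qed
  then have "(\<Sum>n. patch_integral \<rho> (U n) (\<sigma> n) (B n)) \<le> (\<Sum>n. patch_integral \<rho>' (U n) (g \<circ> \<sigma> n) (g ` B n))"
    by (intro suminf_le) auto
  also have "\<dots> \<le> (SUP (U, \<sigma>, B) \<in> {(U, \<sigma>, B). patch_decomposition (g ` S) U \<sigma> B}. \<Sum>n. patch_integral \<rho>' (U n) (\<sigma> n) (B n))"
    by (rule SUP_upper2[of "(U, \<lambda>n. g \<circ> \<sigma> n, \<lambda>n. g ` B n)"])
       (use patch_decomposition_image[OF g \<Omega> S dec] in auto)
  finally show "(\<Sum>n. patch_integral \<rho> (U n) (\<sigma> n) (B n)) \<le> \<dots>" .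
qed

lemma regular_patch_imp_differentiable: "regular_patch S U \<sigma> \<Longrightarrow> w \<in> U \<Longrightarrow> \<sigma> differentiable at w"
  unfolding regular_patch_def using C2_on_imp_differentiable by blast

lemma regular_patch_imp_in: "regular_patch S U \<sigma> \<Longrightarrow> w \<in> U \<Longrightarrow> \<sigma> w \<in> S"
  using openin_imp_subset by (fastforce simp: regular_patch_def)

section \<open>Transport of admissible densities\<close>

lemma borel_measurable_compose_on_open:
  fixes \<phi> :: "heis \<Rightarrow> heis" and \<rho> c :: "heis \<Rightarrow> real"
  assumes W: "open W" and \<phi>: "continuous_on W \<phi>" and c: "continuous_on W c"
    and \<rho>: "\<rho> \<in> borel_measurable borel"
  shows "(\<lambda>x. if x \<in> W then \<rho> (\<phi> x) * c x else 0) \<in> borel_measurable borel"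
proof -
  have [measurable]: "\<phi> \<in> borel_measurable (restrict_space borel W)" "c \<in> borel_measurable (restrict_space borel W)"
    using \<phi> c by (auto intro: borel_measurable_continuous_on_restrict)
  note \<rho>[measurable]
  have "(\<lambda>x. \<rho> (\<phi> x) * c x) \<in> borel_measurable (restrict_space borel W)"
    by measurable
  then show ?thesis
    using W by (subst measurable_If_restrict_space_iff) auto
qed

text \<open>
  With \<open>s = \<bar>Zf\<bar> - \<bar>Zbarf\<bar>\<close> and \<open>t = \<bar>Zf\<bar> + \<bar>Zbarf\<bar>\<close> the conformal factor is \<open>s * t\<close>, the Jacobian is
  \<open>(s * t)\<^sup>2\<close> and the distortion is \<open>t / s\<close>. For the exponent \<open>4/3\<close> the Jacobian absorbs the factors
  by which densities are rescaled, up to a power of the distortion.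
\<close>

lemma powr_distortion_push:
  fixes r s t :: real
  assumes "0 < s" "0 < t" "0 \<le> r"
  shows "(s * t)\<^sup>2 * (r * (1 / (s * t * s))) powr (4/3) = (t / s) powr (2/3) * r powr (4/3)"
proof (cases "r = 0")
  case False
  with assms have "r > 0" by simp
  have "(s * t)\<^sup>2 = (s * t) powr 2"
    using assms by (simp add: powr_numeral)
  then show ?thesis
    using assms \<open>r > 0\<close>
    by (simp add: powr_def ln_mult ln_div flip: exp_add) (simp add: field_simps)
qed simp

lemma powr_distortion_pull:
  fixes r s t :: real
  assumes "0 < s" "0 < t" "0 \<le> r"
  shows "(r * (s * t * t)) powr (4/3) = (t / s) powr (2/3) * ((s * t)\<^sup>2 * r powr (4/3))"
proof (cases "r = 0")
  case False
  with assms have "r > 0" by simp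
  have "(s * t)\<^sup>2 = (s * t) powr 2"
    using assms by (simp add: powr_numeral)
  then show ?thesis
    using assms \<open>r > 0\<close>
    by (simp add: powr_def ln_mult ln_div flip: exp_add) (simp add: field_simps)
qed simp

lemma ennreal_le_mult_INF:
  fixes F :: "'a \<Rightarrow> ennreal"
  assumes "0 < c" and "\<And>x. x \<in> A \<Longrightarrow> M \<le> ennreal c * F x"
  shows "M \<le> ennreal c * (INF x\<in>A. F x)"
proof -
  have inv: "ennreal (1 / c) * (ennreal c * y) = y" "ennreal c * (ennreal (1 / c) * y) = y" for y
    using \<open>0 < c\<close> by (simp_all flip: mult.assoc ennreal_mult'')
  have "ennreal (1 / c) * M \<le> (INF x\<in>A. F x)"
    using mult_left_mono[OF assms(2), of _ "ennreal (1 / c)"] by (intro INF_greatest) (simp add: inv)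
  from mult_left_mono[OF this, of "ennreal c"] show ?thesis
    by (simp add: inv)
qed

context contact_diffeo
begin

abbreviation finv :: "heis \<Rightarrow> heis" where
  "finv \<equiv> inv_into \<Omega> f"

abbreviation stretch_min :: "heis \<Rightarrow> real" where
  "stretch_min p \<equiv> norm (Zf p) - norm (Zbarf p)"

abbreviation stretch_max :: "heis \<Rightarrow> real" where
  "stretch_max p \<equiv> norm (Zf p) + norm (Zbarf p)"

lemma stretch_pos: "p \<in> \<Omega> \<Longrightarrow> 0 < stretch_min p" "p \<in> \<Omega> \<Longrightarrow> 0 < stretch_max p"
  using norm_Zbarf_less[of p] norm_ge_zero[of "Zbarf p"] by linarith+

lemma homeo: "homeomorphism \<Omega> \<Omega>' f finv"
  using C2_diffeomorphism_homeomorphism[OF diffeo] .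

lemma finv: "p \<in> \<Omega> \<Longrightarrow> finv (f p) = p" "q \<in> \<Omega>' \<Longrightarrow> f (finv q) = q"
    "p \<in> \<Omega> \<Longrightarrow> f p \<in> \<Omega>'" "q \<in> \<Omega>' \<Longrightarrow> finv q \<in> \<Omega>" "continuous_on \<Omega>' finv" and image: "f ` \<Omega> = \<Omega>'"
  using homeo by (auto simp: homeomorphism_def)

lemma distortion_eq: "distortion f p = stretch_max p / stretch_min p"
  by (simp add: distortion_def Let_def)

lemma distortion_ge_1: "p \<in> \<Omega> \<Longrightarrow> 1 \<le> distortion f p"
  using stretch_pos[of p] by (simp add: distortion_eq)

lemma nn_integral_f:
  assumes "h \<in> borel_measurable borel" "\<And>q. 0 \<le> h q"
  shows "(\<integral>\<^sup>+q\<in>\<Omega>'. ennreal (h q) \<partial>lborel) = (\<integral>\<^sup>+p\<in>\<Omega>. ennreal ((l p)\<^sup>2 * h (f p)) \<partial>lborel)"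
  unfolding image[symmetric]
proof (rule nn_integral_change_of_variables_heis)
  show "inj_on f \<Omega>"
    by (metis finv(1) inj_onI)
  have "(\<lambda>p. if p \<in> \<Omega> then h (f p) * (l p)\<^sup>2 else 0) \<in> borel_measurable borel"
    by (intro borel_measurable_compose_on_open open_source continuous_f continuous_intros continuous_factor assms)
  then show "(\<lambda>p. indicator \<Omega> p * ((l p)\<^sup>2 * h (f p))) \<in> borel_measurable borel"
    by (rule measurable_cong[THEN iffD1, rotated]) (auto simp: indicator_def)
  show "(f has_derivative Df p) (at p)" if "p \<in> \<Omega>" for p
    using that by (rule Df)
  show "\<bar>det (heis_matrix (Df p))\<bar> = (l p)\<^sup>2" if "p \<in> \<Omega>" for p
    using that by (rule det_Df)
qed (use open_source open_target image assms in auto)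

text \<open>
  The transported densities: \<open>push\<close> moves a density from \<open>\<Omega>\<close> to \<open>\<Omega>'\<close> and divides it by the least
  possible expansion of horizontal area, \<open>pull\<close> moves one from \<open>\<Omega>'\<close> to \<open>\<Omega>\<close> and multiplies it by the
  greatest. Thus neither decreases surface integrals, and both are extended by zero.
\<close>

definition push :: "(heis \<Rightarrow> real) \<Rightarrow> heis \<Rightarrow> real" where
  "push \<rho> q = (if q \<in> \<Omega>' then \<rho> (finv q) * (1 / (l (finv q) * stretch_min (finv q))) else 0)"

definition pull :: "(heis \<Rightarrow> real) \<Rightarrow> heis \<Rightarrow> real" where
  "pull \<rho> p = (if p \<in> \<Omega> then \<rho> (f p) * (l p * stretch_max p) else 0)"

lemma push_measurable:
  assumes "\<rho> \<in> borel_measurable borel"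
  shows "push \<rho> \<in> borel_measurable borel"
proof -
  have "l p * stretch_min p \<noteq> 0" if "p \<in> \<Omega>" for p
    using factor_pos[OF that] stretch_pos(1)[OF that] by simp
  then have "continuous_on \<Omega> (\<lambda>p. 1 / (l p * stretch_min p))"
    by (intro continuous_intros ballI continuous_factor continuous_Zf continuous_Zbarf)
  then have "continuous_on \<Omega>' (\<lambda>q. 1 / (l (finv q) * stretch_min (finv q)))"
    by (rule continuous_on_compose2[OF _ finv(5)]) (use finv(4) in auto)
  then show ?thesis
    unfolding push_def[abs_def]
    by (rule borel_measurable_compose_on_open[OF open_target finv(5) _ assms])
qed

lemma pull_measurable: "\<rho> \<in> borel_measurable borel \<Longrightarrow> pull \<rho> \<in> borel_measurable borel"
  unfolding pull_def[abs_def]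
  by (intro borel_measurable_compose_on_open[OF open_source continuous_f] continuous_intros
      continuous_factor continuous_Zf continuous_Zbarf)

lemma push_nonneg: "(\<And>p. 0 \<le> \<rho> p) \<Longrightarrow> 0 \<le> push \<rho> q"
  unfolding push_def using factor_pos stretch_pos(1) finv(4)
  by (auto intro!: divide_nonneg_nonneg mult_nonneg_nonneg simp: less_imp_le)

lemma pull_nonneg: "(\<And>p. 0 \<le> \<rho> p) \<Longrightarrow> 0 \<le> pull \<rho> p"
  unfolding pull_def using factor_pos by (auto intro!: mult_nonneg_nonneg add_nonneg_nonneg simp: less_imp_le)

lemma surface_integral_push:
  assumes S: "S \<subseteq> \<Omega>" and \<rho>: "\<And>p. 0 \<le> \<rho> p"
  shows "surface_integral S \<rho> \<le> surface_integral (f ` S) (push \<rho>)"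
proof (rule surface_integral_le_image[OF diffeo open_source open_target S])
  fix U \<sigma> w assume patch: "regular_patch S U \<sigma>" "w \<in> U"
  define p where "p = \<sigma> w"
  have p: "p \<in> \<Omega>"
    using regular_patch_imp_in[OF patch] S by (auto simp: p_def)
  define c where "c = l p * stretch_min p"
  have "c > 0"
    using factor_pos[OF p] stretch_pos(1)[OF p] by (simp add: c_def)
  have "c * norm (horizontal_normal \<sigma> w) \<le> norm (horizontal_normal (f \<circ> \<sigma>) w)"
    using horizontal_normal_compose(1)[OF regular_patch_imp_differentiable[OF patch]] p
    by (simp add: c_def p_def)
  then have "\<rho> p / c * (c * norm (horizontal_normal \<sigma> w)) \<le> \<rho> p / c * norm (horizontal_normal (f \<circ> \<sigma>) w)"
    using \<rho> \<open>c > 0\<close> by (intro mult_left_mono) auto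
  then show "\<rho> (\<sigma> w) * norm (horizontal_normal \<sigma> w) \<le> push \<rho> (f (\<sigma> w)) * norm (horizontal_normal (f \<circ> \<sigma>) w)"
    using \<open>c > 0\<close> p by (simp add: push_def finv flip: p_def c_def)
qed

lemma surface_integral_pull:
  assumes S: "S \<subseteq> \<Omega>" and \<rho>: "\<And>p. 0 \<le> \<rho> p"
  shows "surface_integral (f ` S) \<rho> \<le> surface_integral S (pull \<rho>)"
proof -
  have fS: "f ` S \<subseteq> \<Omega>'" and S_eq: "finv ` f ` S = S"
    using S finv(1,3) by (force simp: image_iff)+
  have "surface_integral (f ` S) \<rho> \<le> surface_integral (finv ` f ` S) (pull \<rho>)"
  proof (rule surface_integral_le_image[OF C2_diffeomorphism_inverse[OF diffeo open_source] open_target open_source fS])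
    fix U \<tau> w assume patch: "regular_patch (f ` S) U \<tau>" "w \<in> U"
    have inv_patch: "regular_patch (finv ` f ` S) U (finv \<circ> \<tau>)"
      by (rule regular_patch_image[OF C2_diffeomorphism_inverse[OF diffeo open_source] open_target fS patch(1)])
    have U: "open U"
      using patch(1) by (simp add: regular_patch_def)
    have \<tau>: "\<tau> v \<in> \<Omega>'" if "v \<in> U" for v
      using regular_patch_imp_in[OF patch(1) that] fS by blast
    define p where "p = finv (\<tau> w)"
    have p: "p \<in> \<Omega>" "f p = \<tau> w"
      using \<tau>[OF patch(2)] by (simp_all add: p_def finv)
    \<comment> \<open>The estimate for \<open>f\<close> is applied to the pulled-back patch: composing with \<open>f\<close> gives \<open>\<tau>\<close> back,
      but only on \<open>U\<close>, whence the detour through derivatives.\<close>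
    have "frechet_derivative \<tau> (at w) = frechet_derivative (f \<circ> (finv \<circ> \<tau>)) (at w)"
      using \<tau> by (intro frechet_derivative_transform_within_open[OF regular_patch_imp_differentiable[OF patch] U patch(2)])
        (simp add: finv)
    then have "horizontal_normal (f \<circ> (finv \<circ> \<tau>)) w = horizontal_normal \<tau> w"
      using p by (simp add: horizontal_normal_def p_def)
    then have "norm (horizontal_normal \<tau> w) \<le> l p * stretch_max p * norm (horizontal_normal (finv \<circ> \<tau>) w)"
      using horizontal_normal_compose(2)[OF regular_patch_imp_differentiable[OF inv_patch patch(2)]] p(1)
      by (simp add: p_def)
    then have "\<rho> (\<tau> w) * norm (horizontal_normal \<tau> w)
        \<le> \<rho> (\<tau> w) * (l p * stretch_max p * norm (horizontal_normal (finv \<circ> \<tau>) w))"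
      using \<rho> by (intro mult_left_mono) auto
    then show "\<rho> (\<tau> w) * norm (horizontal_normal \<tau> w)
        \<le> pull \<rho> (finv (\<tau> w)) * norm (horizontal_normal (finv \<circ> \<tau>) w)"
      using p by (simp add: pull_def mult.assoc flip: p_def)
  qed
  then show ?thesis
    by (simp add: S_eq)
qed

lemma nn_integral_push:
  assumes \<rho>: "\<rho> \<in> borel_measurable borel" "\<And>p. 0 \<le> \<rho> p"
  shows "(\<integral>\<^sup>+q. ennreal (push \<rho> q powr (4/3)) \<partial>lborel) =
    (\<integral>\<^sup>+p\<in>\<Omega>. ennreal (distortion f p powr (2/3) * \<rho> p powr (4/3)) \<partial>lborel)"
proof -
  have [measurable]: "push \<rho> \<in> borel_measurable borel"
    by (rule push_measurable[OF \<rho>(1)])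
  have "(\<integral>\<^sup>+q. ennreal (push \<rho> q powr (4/3)) \<partial>lborel) = (\<integral>\<^sup>+q\<in>\<Omega>'. ennreal (push \<rho> q powr (4/3)) \<partial>lborel)"
    by (intro nn_integral_cong) (auto simp: push_def indicator_def)
  also have "\<dots> = (\<integral>\<^sup>+p\<in>\<Omega>. ennreal ((l p)\<^sup>2 * push \<rho> (f p) powr (4/3)) \<partial>lborel)"
    by (rule nn_integral_f) auto
  also have "\<dots> = (\<integral>\<^sup>+p\<in>\<Omega>. ennreal (distortion f p powr (2/3) * \<rho> p powr (4/3)) \<partial>lborel)"
  proof (rule nn_integral_cong)
    fix p
    have "(l p)\<^sup>2 * push \<rho> (f p) powr (4/3) = distortion f p powr (2/3) * \<rho> p powr (4/3)" if "p \<in> \<Omega>"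
      using powr_distortion_push[OF stretch_pos[OF that] \<rho>(2)[of p]] that
      by (simp only: push_def finv distortion_eq factor_eq_norms[OF that] if_True)
    then show "ennreal ((l p)\<^sup>2 * push \<rho> (f p) powr (4/3)) * indicator \<Omega> p =
        ennreal (distortion f p powr (2/3) * \<rho> p powr (4/3)) * indicator \<Omega> p"
      by (auto simp: indicator_def)
  qed
  finally show ?thesis .
qed

lemma nn_integral_pull:
  assumes \<rho>: "\<rho> \<in> borel_measurable borel" "\<And>p. 0 \<le> \<rho> p"
    and K: "AE p in lborel. p \<in> \<Omega> \<longrightarrow> distortion f p \<le> K"
  shows "(\<integral>\<^sup>+p. ennreal (pull \<rho> p powr (4/3)) \<partial>lborel) \<le>
    ennreal (K powr (2/3)) * (\<integral>\<^sup>+q. ennreal (\<rho> q powr (4/3)) \<partial>lborel)"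
proof -
  note \<rho>(1)[measurable]
  have h: "(\<lambda>p. if p \<in> \<Omega> then \<rho> (f p) powr (4/3) * (l p)\<^sup>2 else 0) \<in> borel_measurable borel"
    by (rule borel_measurable_compose_on_open[of _ _ _ "\<lambda>q. \<rho> q powr (4/3)"])
      (auto intro!: open_source continuous_f continuous_intros continuous_factor)
  have "(\<integral>\<^sup>+p. ennreal (pull \<rho> p powr (4/3)) \<partial>lborel) \<le>
      (\<integral>\<^sup>+p. ennreal (K powr (2/3)) * ennreal (if p \<in> \<Omega> then \<rho> (f p) powr (4/3) * (l p)\<^sup>2 else 0) \<partial>lborel)"
  proof (rule nn_integral_mono_AE, use K in eventually_elim)
    fix p assume K: "p \<in> \<Omega> \<longrightarrow> distortion f p \<le> K"
    show "ennreal (pull \<rho> p powr (4/3)) \<le>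
      ennreal (K powr (2/3)) * ennreal (if p \<in> \<Omega> then \<rho> (f p) powr (4/3) * (l p)\<^sup>2 else 0)"
    proof (cases "p \<in> \<Omega>")
      case True
      have "pull \<rho> p powr (4/3) = distortion f p powr (2/3) * ((l p)\<^sup>2 * \<rho> (f p) powr (4/3))"
        using powr_distortion_pull[OF stretch_pos[OF True] \<rho>(2)[of "f p"]] True
        by (simp only: pull_def distortion_eq factor_eq_norms[OF True] if_True)
      also have "\<dots> \<le> K powr (2/3) * ((l p)\<^sup>2 * \<rho> (f p) powr (4/3))"
        using K True distortion_ge_1[OF True] by (intro mult_right_mono powr_mono2) auto
      finally show ?thesis
        using True by (simp add: mult.commute ennreal_leI flip: ennreal_mult)
    qed (simp add: pull_def)
  qed
  also have "\<dots> = ennreal (K powr (2/3)) * (\<integral>\<^sup>+p. ennreal (if p \<in> \<Omega> then \<rho> (f p) powr (4/3) * (l p)\<^sup>2 else 0) \<partial>lborel)"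
    using h by (intro nn_integral_cmult) simp
  also have "(\<integral>\<^sup>+p. ennreal (if p \<in> \<Omega> then \<rho> (f p) powr (4/3) * (l p)\<^sup>2 else 0) \<partial>lborel) =
      (\<integral>\<^sup>+p\<in>\<Omega>. ennreal ((l p)\<^sup>2 * \<rho> (f p) powr (4/3)) \<partial>lborel)"
    by (intro nn_integral_cong) (auto simp: indicator_def mult.commute)
  also have "\<dots> = (\<integral>\<^sup>+q\<in>\<Omega>'. ennreal (\<rho> q powr (4/3)) \<partial>lborel)"
    by (rule nn_integral_f[symmetric]) auto
  also have "ennreal (K powr (2/3)) * \<dots> \<le> ennreal (K powr (2/3)) * (\<integral>\<^sup>+q. ennreal (\<rho> q powr (4/3)) \<partial>lborel)"
    by (intro mult_left_mono nn_integral_mono) (auto simp: indicator_def)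
  finally show ?thesis .
qed

lemma fst_surface_image: "fst (surface_image f S) = f ` fst S"
  by (simp add: surface_image_def case_prod_beta)

lemma Adm_push:
  assumes "\<And>S. S \<in> \<Sigma> \<Longrightarrow> fst S \<subseteq> \<Omega>" and "\<rho> \<in> Adm \<Sigma>"
  shows "push \<rho> \<in> Adm (surface_image f ` \<Sigma>)"
  using assms push_measurable[of \<rho>] push_nonneg[of \<rho>]
  by (auto simp: Adm_def fst_surface_image intro!: order_trans[OF _ surface_integral_push])

lemma Adm_pull:
  assumes "\<And>S. S \<in> \<Sigma> \<Longrightarrow> fst S \<subseteq> \<Omega>" and "\<rho> \<in> Adm (surface_image f ` \<Sigma>)"
  shows "pull \<rho> \<in> Adm \<Sigma>"
  using assms pull_measurable[of \<rho>] pull_nonneg[of \<rho>]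
  by (auto simp: Adm_def fst_surface_image intro!: order_trans[OF _ surface_integral_pull])

lemma Mod_image_le_weighted:
  assumes "\<And>S. S \<in> \<Sigma> \<Longrightarrow> fst S \<subseteq> \<Omega>" and \<rho>: "\<rho> \<in> Adm \<Sigma>"
  shows "Mod (surface_image f ` \<Sigma>)
    \<le> (\<integral>\<^sup>+p\<in>\<Omega>. ennreal (distortion f p powr (2/3) * \<rho> p powr (4/3)) \<partial>lborel)"
  unfolding Mod_def
proof (rule INF_lower2[OF Adm_push[OF assms]])
  show "(\<integral>\<^sup>+q. ennreal (push \<rho> q powr (4/3)) \<partial>lborel)
    \<le> (\<integral>\<^sup>+p\<in>\<Omega>. ennreal (distortion f p powr (2/3) * \<rho> p powr (4/3)) \<partial>lborel)"
    using \<rho> by (subst nn_integral_push) (auto simp: Adm_def)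
qed

context
  fixes K :: real
  assumes K: "AE p in lborel. p \<in> \<Omega> \<longrightarrow> distortion f p \<le> K" and "0 < K"
begin

lemma Mod_image_le:
  assumes "\<And>S. S \<in> \<Sigma> \<Longrightarrow> fst S \<subseteq> \<Omega>"
  shows "Mod (surface_image f ` \<Sigma>) \<le> ennreal (K powr (2/3)) * Mod \<Sigma>"
  unfolding Mod_def[of \<Sigma>]
proof (rule ennreal_le_mult_INF)
  fix \<rho> assume \<rho>: "\<rho> \<in> Adm \<Sigma>"
  then have [measurable]: "\<rho> \<in> borel_measurable borel"
    by (simp add: Adm_def)
  have "Mod (surface_image f ` \<Sigma>)
      \<le> (\<integral>\<^sup>+p\<in>\<Omega>. ennreal (distortion f p powr (2/3) * \<rho> p powr (4/3)) \<partial>lborel)"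
    by (rule Mod_image_le_weighted[OF assms \<rho>])
  also have "\<dots> \<le> (\<integral>\<^sup>+p. ennreal (K powr (2/3)) * ennreal (\<rho> p powr (4/3)) \<partial>lborel)"
  proof (rule nn_integral_mono_AE, use K in eventually_elim)
    fix p assume "p \<in> \<Omega> \<longrightarrow> distortion f p \<le> K"
    then show "ennreal (distortion f p powr (2/3) * \<rho> p powr (4/3)) * indicator \<Omega> p
        \<le> ennreal (K powr (2/3)) * ennreal (\<rho> p powr (4/3))"
      using distortion_ge_1[of p]
      by (auto simp: indicator_def simp flip: ennreal_mult intro!: ennreal_leI mult_right_mono powr_mono2)
  qed
  also have "\<dots> = ennreal (K powr (2/3)) * (\<integral>\<^sup>+p. ennreal (\<rho> p powr (4/3)) \<partial>lborel)"
    by (rule nn_integral_cmult) measurable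
  finally show "Mod (surface_image f ` \<Sigma>) \<le> \<dots>" .
qed (use \<open>0 < K\<close> in simp)

lemma Mod_le_image:
  assumes "\<And>S. S \<in> \<Sigma> \<Longrightarrow> fst S \<subseteq> \<Omega>"
  shows "Mod \<Sigma> \<le> ennreal (K powr (2/3)) * Mod (surface_image f ` \<Sigma>)"
  unfolding Mod_def[of "surface_image f ` \<Sigma>"]
proof (rule ennreal_le_mult_INF)
  fix \<rho> assume \<rho>: "\<rho> \<in> Adm (surface_image f ` \<Sigma>)"
  have "Mod \<Sigma> \<le> (\<integral>\<^sup>+p. ennreal (pull \<rho> p powr (4/3)) \<partial>lborel)"
    unfolding Mod_def by (rule INF_lower[OF Adm_pull[OF assms \<rho>]])
  also have "\<dots> \<le> ennreal (K powr (2/3)) * (\<integral>\<^sup>+q. ennreal (\<rho> q powr (4/3)) \<partial>lborel)"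
    using \<rho> by (intro nn_integral_pull K) (auto simp: Adm_def)
  finally show "Mod \<Sigma> \<le> \<dots>" .
qed (use \<open>0 < K\<close> in simp)

end

text \<open>
  The essential supremum bounds the distortion almost everywhere, and that suffices under the
  integral sign.
\<close>

lemma AE_distortion_le_max: "AE p in lborel. p \<in> \<Omega> \<longrightarrow> ereal (distortion f p) \<le> max_distortion f \<Omega>"
  using esssup_AE[where M = "restrict_space lborel \<Omega>" and f = "\<lambda>p. ereal (distortion f p)"] open_source
  by (simp add: AE_restrict_space_iff max_distortion_def)

text \<open>
  Distortion is at least one at every point. An open non-empty set is not negligible, so the
  essential supremum inherits the bound; in particular it is not \<open>-\<infinity>\<close>, and converting it to a real
  number loses nothing.
\<close>

lemma max_distortion_ge_1:
  assumes "\<Omega> \<noteq> {}"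
  shows "1 \<le> max_distortion f \<Omega>"
proof (rule ccontr)
  assume less: "\<not> 1 \<le> max_distortion f \<Omega>"
  have "AE p in lborel. p \<notin> \<Omega>"
    using AE_distortion_le_max
  proof eventually_elim
    fix p assume "p \<in> \<Omega> \<longrightarrow> ereal (distortion f p) \<le> max_distortion f \<Omega>"
    moreover have "p \<in> \<Omega> \<Longrightarrow> 1 \<le> ereal (distortion f p)"
      using distortion_ge_1[of p] by (simp add: one_ereal_def)
    ultimately show "p \<notin> \<Omega>"
      using less order_trans by blast
  qed
  then have "\<Omega> \<in> null_sets lborel"
    using open_source by (simp add: AE_iff_null_sets)
  then have "negligible \<Omega>"
    by (simp add: negligible_iff_null_sets null_sets_completionI)
  then show False
    using open_not_negligible[OF open_source assms] by blast
qed

end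

section \<open>Quasi-invariance of the modulus\<close>

theorem theorem4p2:
  fixes \<Omega> \<Omega>' :: "heis set" and f :: "heis \<Rightarrow> heis" and \<Sigma> :: "oriented_surface set"
  assumes "is_domain \<Omega>" and "is_domain \<Omega>'"
    and "contact_transformation f \<Omega> \<Omega>'"
    and "orientation_preserving f \<Omega>"
    and "quasiconformal f \<Omega>"
    and "\<forall>S\<in>\<Sigma>. oriented_regular_surface S \<and> fst S \<subseteq> \<Omega>"
  shows "(\<forall>\<rho>\<in>Adm \<Sigma>.
            Mod (surface_image f ` \<Sigma>)
              \<le> (\<integral>\<^sup>+ p\<in>\<Omega>. ennreal (distortion f p powr (2/3) * \<rho> p powr (4/3)) \<partial>lborel)) \<and>
         (let K = real_of_ereal (max_distortion f \<Omega>) in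
            ennreal (1 / K powr (2/3)) * Mod \<Sigma> \<le> Mod (surface_image f ` \<Sigma>) \<and>
            Mod (surface_image f ` \<Sigma>) \<le> ennreal (K powr (2/3)) * Mod \<Sigma>)"
proof -
  obtain l where l: "conformal_factor f \<Omega> l" "\<And>p. p \<in> \<Omega> \<Longrightarrow> l p > 0"
    using assms(4) by (auto simp: orientation_preserving_def)
  interpret contact_diffeo \<Omega> \<Omega>' f l
    using assms l by unfold_locales (auto simp: is_domain_def contact_transformation_def)
  have sub: "fst S \<subseteq> \<Omega>" if "S \<in> \<Sigma>" for S
    using assms(6) that by blast
  define K where "K = real_of_ereal (max_distortion f \<Omega>)"
  have ge1: "1 \<le> max_distortion f \<Omega>"
    using assms(1) by (intro max_distortion_ge_1) (simp add: is_domain_def)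
  moreover have "max_distortion f \<Omega> < \<infinity>"
    using assms(5) by (simp add: quasiconformal_def)
  ultimately have K_eq: "max_distortion f \<Omega> = ereal K"
    unfolding K_def by (cases "max_distortion f \<Omega>") auto
  have "K \<ge> 1"
    using ge1 by (simp add: K_eq one_ereal_def)
  have AE: "AE p in lborel. p \<in> \<Omega> \<longrightarrow> distortion f p \<le> K"
    using AE_distortion_le_max by (simp add: K_eq)
  have "ennreal (1 / K powr (2/3)) * Mod \<Sigma>
      \<le> ennreal (1 / K powr (2/3)) * (ennreal (K powr (2/3)) * Mod (surface_image f ` \<Sigma>))"
    using \<open>K \<ge> 1\<close> by (intro mult_left_mono Mod_le_image[OF AE] sub) auto
  also have "\<dots> = Mod (surface_image f ` \<Sigma>)"
    using \<open>K \<ge> 1\<close> by (simp flip: mult.assoc ennreal_mult'')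
  finally show ?thesis
    using Mod_image_le_weighted[of \<Sigma>] Mod_image_le[OF AE, of \<Sigma>] sub \<open>K \<ge> 1\<close>
    by (simp add: Let_def flip: K_def)
qed

end
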